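(* Let $X$ be a compact metric space with metric $d$, let $f\colon X\to X$ be a homeomorphism, and let $\Lambda$ be a closed subset of $X$ with $f(\Lambda)=\Lambda$. Suppose that $f$ has shadowing on $\Lambda$ and that $f$ is expansive on $B_b(\Lambda)$ for some $b>0$. Then the following conditions are equivalent: (1) $Sen(f|_{CR(f|_\Lambda)})=\emptyset$; (2) $h_{\rm top}(f|_{\Lambda_\epsilon})=0$ for some $\epsilon>0$, where $\Lambda_\epsilon=\bigcap_{i\in\mathbb{Z}}f^i(B_\epsilon(\Lambda))$; (3) for every $c>0$, there is a closed subset $\Gamma_c$ of $X$ with $f(\Gamma_c)=\Gamma_c$ such that $\Gamma_c$ is locally maximal, $\Lambda\subset\Gamma_c\subset B_c(\Lambda)$, and $h_{\rm top}(f|_{\Gamma_c})=0$.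
   Context: For $S\subset X$ and $r>0$, $B_r(S)=\{y\in X\colon d(y,S)\le r\}$, where $d(y,S)=\inf_{z\in S}d(y,z)$. Chain recurrence: for a continuous self-map $g$ of a compact metric space $(Z,d)$ and $\delta>0$, a $\delta$-chain of $g$ is a sequence $(x_i)_{i=0}^k$ in $Z$, $k\ge1$, with $d(g(x_i),x_{i+1})\le\delta$ for $0\le i\le k-1$. $CR(g)$ is the set of $x\in Z$ such that for every $\delta>0$ there is a $\delta$-chain of $g$ with $x_0=x_k=x$; it is closed and $g(CR(g))=CR(g)$. Here $CR(f|_\Lambda)$ is formed for the map $f|_\Lambda\colon\Lambda\to\Lambda$. Sensitive points: for a continuous self-map $g\colon Z\to Z$ of a compact metric space $(Z,d)$ and $a>0$, $Sen_a(g)$ is the set of $x\in Z$ such that for every $\delta>0$ there is $y\in Z$ with $d(x,y)\le\delta$ and $d(g^i(x),g^i(y))>a$ for some $i\ge0$; $Sen(g)=\bigcup_{a>0}Sen_a(g)$. Here it is applied to $f$ restricted to $Z=CR(f|_\Lambda)$. Shadowing on a subset: a sequence $(x_i)_{i\in\mathbb{Z}}$ in $X$ is a $\delta$-pseudo orbit of $f$ if $d(f(x_i),x_{i+1})\le\delta$ for all $i\in\mathbb{Z}$; it is $\epsilon$-shadowed by $x\in X$ if $d(x_i,f^i(x))\le\epsilon$ for all $i\in\mathbb{Z}$. For $S\subset X$, $f$ has shadowing on $S$ if for every $\epsilon>0$ there is $\delta>0$ such that every $\delta$-pseudo orbit $(x_i)_{i\in\mathbb{Z}}$ of $f$ with $x_i\in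 S$ for all $i$ is $\epsilon$-shadowed by some $x\in X$ (not necessarily in $S$). Expansive on a subset: for $S\subset X$, $f$ is expansive on $S$ if there is $e>0$ such that for all $x,y\in\bigcap_{i\in\mathbb{Z}}f^i(S)$, $\sup_{i\in\mathbb{Z}}d(f^i(x),f^i(y))\le e$ implies $x=y$. Locally maximal: a closed $S\subset X$ with $f(S)=S$ is locally maximal if there is $r>0$ with $S=\bigcap_{i\in\mathbb{Z}}f^i(B_r(S))$. Topological entropy: for continuous $g\colon Z\to Z$, $n\ge1$, $r>0$, a set $E\subset Z$ is $(n,r)$-separated if $\max_{0\le i\le n-1}d(g^i(x),g^i(y))>r$ for all distinct $x,y\in E$; $s_n(g,r)$ is the largest cardinality of such $E$, and $h_{\rm top}(g)=\lim_{r\to0}\limsup_{n\to\infty}\frac1n\log s_n(g,r)$. *)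

theory Defs
  imports "HOL-Analysis.Analysis"
begin

text \<open>
  The ambient compact metric space is a whole type. A restricted map such as \<open>f|\<^sub>\<Lambda>\<close> is represented by
  the map together with the invariant set \<open>Z\<close> it acts on.
\<close>

definition iter_int :: "('a \<Rightarrow> 'a) \<Rightarrow> int \<Rightarrow> 'a \<Rightarrow> 'a" where
  "iter_int f i = (if i \<ge> 0 then f ^^ nat i else inv f ^^ nat (- i))"

definition invariant_part :: "('a \<Rightarrow> 'a) \<Rightarrow> 'a set \<Rightarrow> 'a set" where
  "invariant_part f S = (\<Inter>i. iter_int f i ` S)"

text \<open>
  The library sets \<open>infdist y {} = 0\<close>, whereas the infimum over the empty set is \<open>\<infinity>\<close>; the guard
  \<open>S \<noteq> {}\<close> makes the neighbourhood of the empty set empty.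
\<close>

definition closed_nbhd :: "real \<Rightarrow> 'a::metric_space set \<Rightarrow> 'a set" where
  "closed_nbhd r S = {y. S \<noteq> {} \<and> infdist y S \<le> r}"

definition delta_chain ::
    "'a::metric_space set \<Rightarrow> ('a \<Rightarrow> 'a) \<Rightarrow> real \<Rightarrow> nat \<Rightarrow> (nat \<Rightarrow> 'a) \<Rightarrow> bool" where
  "delta_chain Z g \<delta> k x \<longleftrightarrow>
     k \<ge> 1 \<and> (\<forall>i\<le>k. x i \<in> Z) \<and> (\<forall>i<k. dist (g (x i)) (x (Suc i)) \<le> \<delta>)"

definition chain_recurrent_set :: "'a::metric_space set \<Rightarrow> ('a \<Rightarrow> 'a) \<Rightarrow> 'a set" where
  "chain_recurrent_set Z g =
     {x \<in> Z. \<forall>\<delta>>0. \<exists>k c. delta_chain Z g \<delta> k c \<and> c 0 = x \<and> c k = x}"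

definition sensitive_points_at ::
    "real \<Rightarrow> 'a::metric_space set \<Rightarrow> ('a \<Rightarrow> 'a) \<Rightarrow> 'a set" where
  "sensitive_points_at a Z g =
     {x \<in> Z. \<forall>\<delta>>0. \<exists>y\<in>Z. dist x y \<le> \<delta> \<and> (\<exists>i. dist ((g ^^ i) x) ((g ^^ i) y) > a)}"

definition sensitive_points :: "'a::metric_space set \<Rightarrow> ('a \<Rightarrow> 'a) \<Rightarrow> 'a set" where
  "sensitive_points Z g = (\<Union>a\<in>{0<..}. sensitive_points_at a Z g)"

definition pseudo_orbit ::
    "('a::metric_space \<Rightarrow> 'a) \<Rightarrow> real \<Rightarrow> (int \<Rightarrow> 'a) \<Rightarrow> bool" where
  "pseudo_orbit f \<delta> x \<longleftrightarrow> (\<forall>i. dist (f (x i)) (x (i + 1)) \<le> \<delta>)"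

definition shadowed_by ::
    "('a::metric_space \<Rightarrow> 'a) \<Rightarrow> real \<Rightarrow> (int \<Rightarrow> 'a) \<Rightarrow> 'a \<Rightarrow> bool" where
  "shadowed_by f \<epsilon> x z \<longleftrightarrow> (\<forall>i. dist (x i) (iter_int f i z) \<le> \<epsilon>)"

definition shadowing_on :: "('a::metric_space \<Rightarrow> 'a) \<Rightarrow> 'a set \<Rightarrow> bool" where
  "shadowing_on f S \<longleftrightarrow>
     (\<forall>\<epsilon>>0. \<exists>\<delta>>0. \<forall>x. pseudo_orbit f \<delta> x \<and> (\<forall>i. x i \<in> S) \<longrightarrow> (\<exists>z. shadowed_by f \<epsilon> x z))"

definition expansive_on :: "('a::metric_space \<Rightarrow> 'a) \<Rightarrow> 'a set \<Rightarrow> bool" where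
  "expansive_on f S \<longleftrightarrow>
     (\<exists>e>0. \<forall>x\<in>invariant_part f S. \<forall>y\<in>invariant_part f S.
        (SUP i. ereal (dist (iter_int f i x) (iter_int f i y))) \<le> ereal e \<longrightarrow> x = y)"

definition locally_maximal :: "('a::metric_space \<Rightarrow> 'a) \<Rightarrow> 'a set \<Rightarrow> bool" where
  "locally_maximal f S \<longleftrightarrow>
     closed S \<and> f ` S = S \<and> (\<exists>r>0. S = invariant_part f (closed_nbhd r S))"

definition separated ::
    "('a::metric_space \<Rightarrow> 'a) \<Rightarrow> nat \<Rightarrow> real \<Rightarrow> 'a set \<Rightarrow> bool" where
  "separated g n r E \<longleftrightarrow>
     (\<forall>x\<in>E. \<forall>y\<in>E. x \<noteq> y \<longrightarrow> Max ((\<lambda>i. dist ((g ^^ i) x) ((g ^^ i) y)) ` {..<n}) > r)"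

text \<open>
  The maximum below exists when \<open>Z\<close> is compact, \<open>g\<close> is continuous on \<open>Z\<close>, \<open>g ` Z \<subseteq> Z\<close>, \<open>n \<ge> 1\<close>
  and \<open>r > 0\<close>; in that case every separated subset of \<open>Z\<close> is finite.
\<close>

definition max_separated ::
    "'a::metric_space set \<Rightarrow> ('a \<Rightarrow> 'a) \<Rightarrow> nat \<Rightarrow> real \<Rightarrow> nat" where
  "max_separated Z g n r = Max {card E | E. finite E \<and> E \<subseteq> Z \<and> separated g n r E}"

text \<open>
  Since \<open>ln 0 = 0\<close> in the library, the empty system has entropy \<open>0\<close>, which is the usual convention.
\<close>

definition topological_entropy :: "'a::metric_space set \<Rightarrow> ('a \<Rightarrow> 'a) \<Rightarrow> ereal" where
  "topological_entropy Z g =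
     Lim (at_right 0)
       (\<lambda>r::real. limsup (\<lambda>n. ereal (1 / real n * ln (real (max_separated Z g n r)))))"

end

theory Submission
  imports Defs
begin

text \<open>
  Write \<open>P\<close> for the chain recurrent set of \<open>f\<close> on \<open>\<Lambda>\<close> and \<open>V \<epsilon>\<close> for the set of points whose whole orbit
  stays in the closed \<open>\<epsilon>\<close>-neighbourhood of \<open>\<Lambda>\<close>. The three conditions are proved equivalent in a cycle:
  absence of sensitive points gives, by expansivity, locally maximal sets of zero entropy; these give
  zero entropy of some \<open>V \<epsilon>\<close>; and this, by shadowing, excludes sensitive points.

  A sensitive point forces positive entropy (\<open>sensitive_imp_entropy_nonzero\<close>). Let \<open>x \<in> P\<close> be sensitive. Then there is \<open>y \<in> P\<close> as close to
  \<open>x\<close> as desired whose orbit separates from that of \<open>x\<close> at some time \<open>i\<close>. Chain recurrence gives a closed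
  chain in \<open>\<Lambda>\<close> that starts at \<open>x\<close>, follows its orbit up to time \<open>i\<close> and comes back, and another one for
  \<open>y\<close>; repeating them makes their lengths equal to a common number \<open>m\<close>. Since \<open>x\<close> and \<open>y\<close> are close, the two
  loops can be concatenated in any order. Shadowing the resulting pseudo orbits gives \<open>2 ^ n\<close>
  separated orbits of length \<open>m * n\<close>, all of them in \<open>V \<epsilon>\<close>, so the entropy there is at least \<open>ln 2 / m\<close>.

  A locally maximal set absorbs some \<open>V r\<close> (\<open>locally_maximal_imp_entropy_0_nbhd\<close>). If \<open>\<Gamma> \<supseteq> \<Lambda>\<close> is the maximal invariant set of its own
  closed \<open>r\<close>-neighbourhood, then \<open>V r \<subseteq> \<Gamma>\<close>, and entropy is monotone in the set.

  Suppose now that there are no sensitive points (\<open>insensitive_imp_locally_maximal_entropy_0\<close>).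
  Equicontinuity in positive time together with expansivity makes \<open>P\<close> finite (\<open>insensitive_expansive_finite\<close>). By compactness, a point of \<open>\<Lambda>\<close> away from \<open>P\<close>
  has no \<open>\<delta>\<close>-chain back to itself, for one uniform \<open>\<delta>\<close>. For small \<open>\<epsilon>\<close> the orbit of a point of \<open>V \<epsilon>\<close> is
  traced by a pseudo orbit in \<open>\<Lambda>\<close>, which by the pigeonhole principle visits the region away from \<open>P\<close> a
  bounded number of times; near \<open>P\<close> it has to follow the permutation that \<open>f\<close> induces on \<open>P\<close>. So every
  orbit in \<open>V \<epsilon>\<close> has an itinerary over a finite alphabet that is deterministic except at a bounded
  number of times (\<open>sparse_itineraries_near\<close>). By expansivity a point is determined by its itinerary.
  There are only countably many such itineraries, and polynomially many finite pieces of length \<open>n\<close>.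
  Hence \<open>V \<epsilon>\<close> is countable and has zero entropy.

  It remains to find a locally maximal set among the \<open>V \<epsilon>\<close> (\<open>locally_maximal_nbhd\<close>). The distances to
  \<open>\<Lambda>\<close> of the points of a countable \<open>V \<epsilon>0\<close> form a compact countable set of reals. If \<open>\<epsilon> < \<epsilon>0\<close> lies outside
  that set, then so does an interval around \<open>\<epsilon>\<close>, which makes \<open>V\<close> constant just to the right of \<open>\<epsilon>\<close>.
\<close>

section \<open>Integer iterates of a homeomorphism of a compact space\<close>

locale compact_homeo =
  fixes f :: "'a::metric_space \<Rightarrow> 'a"
  assumes compact_space: "compact (UNIV :: 'a set)"
    and homeo: "homeomorphism UNIV UNIV f (inv f)"
begin

lemma f_inv [simp]: "f (inv f x) = x"
  using homeo by (simp add: homeomorphism_def)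

lemma inv_f [simp]: "inv f (f x) = x"
  using homeo by (simp add: homeomorphism_def)

lemma f_eq_iff [simp]: "f x = f y \<longleftrightarrow> x = y"
  by (metis inv_f)

lemma closed_imp_compact: "closed S \<Longrightarrow> compact (S :: 'a set)"
  using compact_Int_closed[OF compact_space, of S] by simp

lemma iter_int_0 [simp]: "iter_int f 0 x = x"
  by (simp add: iter_int_def)

lemma iter_int_of_nat: "iter_int f (int n) x = (f ^^ n) x"
  by (simp add: iter_int_def)

lemma iter_int_succ: "iter_int f (i + 1) x = f (iter_int f i x)"
proof (cases "i \<ge> 0")
  case True
  then have "nat (i + 1) = Suc (nat i)" by simp
  then show ?thesis using True by (simp add: iter_int_def)
next
  case False
  then have "nat (- i) = Suc (nat (- (i + 1)))" by simp
  then have *: "iter_int f i x = inv f ((inv f ^^ nat (- (i + 1))) x)"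
    using False by (simp add: iter_int_def)
  show ?thesis
  proof (cases "i = - 1")
    case True
    then show ?thesis using * by (simp add: iter_int_def)
  next
    case F: False
    then show ?thesis using * False by (simp add: iter_int_def)
  qed
qed

lemma iter_int_pred: "iter_int f (i - 1) x = inv f (iter_int f i x)"
  using iter_int_succ[of "i - 1" x] by (metis diff_add_cancel inv_f)

lemma iter_int_add: "iter_int f (i + j) x = iter_int f i (iter_int f j x)"
proof (induction i rule: int_induct[where k = 0])
  case base
  then show ?case by simp
next
  case (step1 i)
  have "iter_int f (i + 1 + j) x = iter_int f ((i + j) + 1) x" by (simp add: algebra_simps)
  then show ?case using step1 by (simp only: iter_int_succ)
next
  case (step2 i)
  have "iter_int f (i - 1 + j) x = iter_int f ((i + j) - 1) x" by (simp add: algebra_simps)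
  then show ?case using step2 by (simp only: iter_int_pred)
qed

lemma continuous_iter_int: "continuous_on UNIV (iter_int f i)"
proof (induction i rule: int_induct[where k = 0])
  case base
  have "iter_int f 0 = (\<lambda>x. x)" by (simp add: fun_eq_iff)
  then show ?case by (simp add: continuous_on_id)
next
  case (step1 i)
  have "iter_int f (i + 1) = f \<circ> iter_int f i" by (simp add: fun_eq_iff iter_int_succ)
  moreover have "continuous_on UNIV f" using homeo by (simp add: homeomorphism_def)
  ultimately show ?case
    using step1 by (metis continuous_on_compose continuous_on_subset top_greatest)
next
  case (step2 i)
  have "iter_int f (i - 1) = inv f \<circ> iter_int f i" by (simp add: fun_eq_iff iter_int_pred)
  moreover have "continuous_on UNIV (inv f)" using homeo by (simp add: homeomorphism_def)
  ultimately show ?case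
    using step2 by (metis continuous_on_compose continuous_on_subset top_greatest)
qed

lemma uniform_continuity:
  assumes "continuous_on UNIV (g :: 'a \<Rightarrow> 'a)" "0 < e"
  obtains d where "0 < d" "d \<le> e" "\<And>x y. dist x y \<le> d \<Longrightarrow> dist (g x) (g y) \<le> e"
proof -
  have "uniformly_continuous_on UNIV g"
    using compact_uniformly_continuous assms(1) compact_space by blast
  then obtain d where d: "d > 0" "\<And>x y. dist x y < d \<Longrightarrow> dist (g x) (g y) < e"
    unfolding uniformly_continuous_on_def using assms(2) by (metis UNIV_I dist_commute)
  show ?thesis
  proof (rule that[of "min (d / 2) e"])
    fix x y :: 'a assume "dist x y \<le> min (d / 2) e"
    then have "dist x y < d" using d(1) by linarith
    then show "dist (g x) (g y) \<le> e" using d(2) by force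
  qed (use d(1) assms(2) in auto)
qed

lemma continuous_f: "continuous_on UNIV f" and continuous_inv_f: "continuous_on UNIV (inv f)"
  using homeo by (auto simp: homeomorphism_def)

lemma finite_net:
  assumes "0 < e"
  obtains K :: "'a set" where "finite K" "\<And>x. \<exists>k\<in>K. dist x k \<le> e"
proof -
  obtain K :: "'a set" where K: "finite K" "UNIV \<subseteq> (\<Union>x\<in>K. ball x e)"
    using compact_space assms unfolding compact_eq_totally_bounded by blast
  show ?thesis
  proof (rule that[OF K(1)])
    fix x show "\<exists>k\<in>K. dist x k \<le> e"
    proof -
      obtain k where "k \<in> K" "x \<in> ball k e" using K(2) by blast
      then show ?thesis by (auto simp: dist_commute intro!: bexI[of _ k])
    qed
  qed
qed

section \<open>Invariant parts of neighbourhoods\<close>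

lemma invariant_part_iff: "z \<in> invariant_part f S \<longleftrightarrow> (\<forall>i. iter_int f i z \<in> S)"
proof
  assume z: "z \<in> invariant_part f S"
  show "\<forall>i. iter_int f i z \<in> S"
  proof
    fix i
    obtain s where "s \<in> S" "z = iter_int f (- i) s"
      using z unfolding invariant_part_def by blast
    then show "iter_int f i z \<in> S" using iter_int_add[of i "- i" s] by simp
  qed
next
  assume *: "\<forall>i. iter_int f i z \<in> S"
  have "z = iter_int f i (iter_int f (- i) z)" for i
    using iter_int_add[of i "- i" z] by simp
  then show "z \<in> invariant_part f S"
    unfolding invariant_part_def using * by blast
qed

lemma iter_int_in_invariant_part:
  "z \<in> invariant_part f S \<Longrightarrow> iter_int f i z \<in> invariant_part f S"
  by (simp add: invariant_part_iff iter_int_add[symmetric])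

lemma iter_int_in_invariant:
  assumes "f ` Y = Y" "y \<in> Y"
  shows "iter_int f i y \<in> Y"
proof (induction i rule: int_induct[where k = 0])
  case base
  then show ?case using assms by simp
next
  case (step1 i)
  then show ?case using assms(1) by (metis image_eqI iter_int_succ)
next
  case (step2 i)
  then obtain u where "u \<in> Y" "iter_int f i y = f u" using assms(1) by blast
  then show ?case by (simp add: iter_int_pred)
qed

lemma image_invariant_part: "f ` invariant_part f S = invariant_part f S"
proof (intro equalityI subsetI)
  fix z assume "z \<in> f ` invariant_part f S"
  then obtain u where "u \<in> invariant_part f S" "z = f u" by blast
  then show "z \<in> invariant_part f S"
    using iter_int_in_invariant_part[of u S 1] iter_int_succ[of 0 u] by simp
next
  fix z assume "z \<in> invariant_part f S"
  then have "inv f z \<in> invariant_part f S"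
    using iter_int_in_invariant_part[of z S "- 1"] iter_int_pred[of 0 z] by simp
  then show "z \<in> f ` invariant_part f S" by (metis f_inv image_eqI)
qed

lemma closed_invariant_part:
  assumes "closed S"
  shows "closed (invariant_part f S)"
proof -
  have "invariant_part f S = (\<Inter>i. iter_int f i -` S)"
    by (auto simp: invariant_part_iff)
  moreover have "closed (iter_int f i -` S)" for i
    using continuous_closed_vimage assms continuous_iter_int
    by (metis continuous_on_closed_vimage Int_UNIV_right closed_UNIV)
  ultimately show ?thesis by auto
qed

lemma invariant_part_subset: "invariant_part f S \<subseteq> S"
  by (metis invariant_part_iff iter_int_0 subsetI)

lemma invariant_part_mono: "S \<subseteq> T \<Longrightarrow> invariant_part f S \<subseteq> invariant_part f T"
  unfolding invariant_part_def by blast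

lemma invariant_subset_invariant_part: "f ` Y = Y \<Longrightarrow> Y \<subseteq> S \<Longrightarrow> Y \<subseteq> invariant_part f S"
  using iter_int_in_invariant[of Y] unfolding subset_iff invariant_part_iff by metis

end

lemma closed_closed_nbhd: "closed (closed_nbhd r S)"
proof (cases "S = {}")
  case False
  then have "closed_nbhd r S = {y. infdist y S \<le> r}" by (auto simp: closed_nbhd_def)
  then show ?thesis by (simp add: closed_Collect_le continuous_on_infdist)
qed (simp add: closed_nbhd_def)

lemma closed_nbhd_mono_radius: "r \<le> s \<Longrightarrow> closed_nbhd r S \<subseteq> closed_nbhd s S"
  by (auto simp: closed_nbhd_def)

lemma subset_closed_nbhd: "0 \<le> r \<Longrightarrow> S \<subseteq> closed_nbhd r S"
  by (auto simp: closed_nbhd_def)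

lemma closed_nbhd_mono: "S \<subseteq> T \<Longrightarrow> closed_nbhd r S \<subseteq> closed_nbhd r T"
  using infdist_mono[of S T] by (auto simp: closed_nbhd_def intro: order_trans)

lemma closed_nbhdI: "y \<in> S \<Longrightarrow> dist z y \<le> r \<Longrightarrow> z \<in> closed_nbhd r S"
  using infdist_le2[of y S z r] by (auto simp: closed_nbhd_def)

text \<open>
  The infimum defining the distance to \<open>S\<close> may fail to be attained, hence the slack between
  \<open>r\<close> and \<open>s\<close>.
\<close>

lemma closed_nbhdE:
  assumes "z \<in> closed_nbhd r S" "r < s"
  obtains y where "y \<in> S" "dist z y < s"
proof -
  have "S \<noteq> {}" "infdist z S < s" using assms by (auto simp: closed_nbhd_def)
  then show ?thesis
    using that cInf_lessD[of "dist z ` S" s] by (auto simp: infdist_def)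
qed

section \<open>Chains as paths of a relation\<close>

definition step_rel :: "'a::metric_space set \<Rightarrow> ('a \<Rightarrow> 'a) \<Rightarrow> real \<Rightarrow> 'a \<Rightarrow> 'a \<Rightarrow> bool" where
  "step_rel Z g \<delta> u v \<longleftrightarrow> u \<in> Z \<and> v \<in> Z \<and> dist (g u) v \<le> \<delta>"

text \<open>
  Chains are handled as paths of a relation, so that concatenating, cutting and changing them
  becomes transitive closure reasoning.
\<close>

lemma delta_chain_iff_tranclp:
  "(\<exists>k c. delta_chain Z g \<delta> k c \<and> c 0 = x \<and> c k = y) \<longleftrightarrow> (step_rel Z g \<delta>)\<^sup>+\<^sup>+ x y"
proof
  assume "\<exists>k c. delta_chain Z g \<delta> k c \<and> c 0 = x \<and> c k = y"
  then obtain k c where c: "delta_chain Z g \<delta> k c" "c 0 = x" "c k = y" by blast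
  then have "k > 0" "(step_rel Z g \<delta> ^^ k) x y"
    by (auto simp: delta_chain_def step_rel_def relpowp_fun_conv intro!: exI[of _ c])
  then show "(step_rel Z g \<delta>)\<^sup>+\<^sup>+ x y" by (auto simp: tranclp_power)
next
  assume "(step_rel Z g \<delta>)\<^sup>+\<^sup>+ x y"
  then obtain k where k: "k > 0" "(step_rel Z g \<delta> ^^ k) x y" by (auto simp: tranclp_power)
  then obtain c where c: "c 0 = x" "c k = y" "\<And>i. i < k \<Longrightarrow> step_rel Z g \<delta> (c i) (c (Suc i))"
    by (auto simp: relpowp_fun_conv)
  have "c i \<in> Z" if "i \<le> k" for i
  proof (cases "i = k")
    case True
    then show ?thesis using c(3)[of "k - 1"] k(1) by (simp add: step_rel_def)
  next
    case False
    then show ?thesis using c(3)[of i] that by (simp add: step_rel_def)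
  qed
  then have "delta_chain Z g \<delta> k c"
    using k(1) c(3) by (auto simp: delta_chain_def step_rel_def)
  then show "\<exists>k c. delta_chain Z g \<delta> k c \<and> c 0 = x \<and> c k = y" using c by blast
qed

lemma chain_recurrent_set_iff:
  "x \<in> chain_recurrent_set Z g \<longleftrightarrow> x \<in> Z \<and> (\<forall>\<delta>>0. (step_rel Z g \<delta>)\<^sup>+\<^sup>+ x x)"
  by (simp add: chain_recurrent_set_def delta_chain_iff_tranclp)

lemma step_rel_mono: "\<delta> \<le> \<delta>' \<Longrightarrow> step_rel Z g \<delta> \<le> step_rel Z g \<delta>'"
  by (auto simp: step_rel_def)

lemma tranclp_step_rel_mono:
  assumes "\<delta> \<le> \<delta>'" "(step_rel Z g \<delta>)\<^sup>+\<^sup>+ x y"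
  shows "(step_rel Z g \<delta>')\<^sup>+\<^sup>+ x y"
proof -
  have le: "step_rel Z g \<delta> u v \<Longrightarrow> step_rel Z g \<delta>' u v" for u v
    using step_rel_mono[OF assms(1)] by blast
  show ?thesis
    using assms(2) by (induction rule: tranclp_induct) (auto dest: le intro: tranclp.intros)
qed

lemma rtranclp_step_rel_mono:
  "\<delta> \<le> \<delta>' \<Longrightarrow> (step_rel Z g \<delta>)\<^sup>*\<^sup>* x y \<Longrightarrow> (step_rel Z g \<delta>')\<^sup>*\<^sup>* x y"
  using rtranclp_mono[OF step_rel_mono] by blast

text \<open>
  Only the last step of the chain sees its end point, so moving that point by \<open>\<eta>\<close> costs one \<open>\<eta>\<close>. In the
  same way only the first step sees the start, through its image.
\<close>

lemma step_rel_change_end: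
  assumes "(step_rel Z g \<delta>)\<^sup>+\<^sup>+ x y" "dist y y' \<le> \<eta>" "y' \<in> Z" "0 \<le> \<eta>"
  shows "(step_rel Z g (\<delta> + \<eta>))\<^sup>+\<^sup>+ x y'"
proof -
  obtain u where u: "(step_rel Z g \<delta>)\<^sup>*\<^sup>* x u" "step_rel Z g \<delta> u y"
    using assms(1) by (metis tranclpD tranclp.cases rtranclp.rtrancl_refl tranclp_into_rtranclp)
  have "step_rel Z g (\<delta> + \<eta>) u y'"
    using u(2) assms(2,3) dist_triangle[of "g u" y' y] by (auto simp: step_rel_def)
  then show ?thesis
    using rtranclp_step_rel_mono[OF _ u(1), of "\<delta> + \<eta>"] assms(4) by (simp add: rtranclp_into_tranclp1)
qed

lemma step_rel_change_start:
  assumes "(step_rel Z g \<delta>)\<^sup>+\<^sup>+ x y" "dist (g x') (g x) \<le> \<eta>" "x' \<in> Z" "0 \<le> \<eta>"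
  shows "(step_rel Z g (\<delta> + \<eta>))\<^sup>+\<^sup>+ x' y"
proof -
  obtain u where u: "step_rel Z g \<delta> x u" "(step_rel Z g \<delta>)\<^sup>*\<^sup>* u y"
    using assms(1) by (metis tranclpD)
  have "step_rel Z g (\<delta> + \<eta>) x' u"
    using u(1) assms(2,3) dist_triangle[of "g x'" u "g x"] by (auto simp: step_rel_def)
  then show ?thesis
    using rtranclp_step_rel_mono[OF _ u(2), of "\<delta> + \<eta>"] assms(4) by (simp add: rtranclp_into_tranclp2)
qed

lemma step_rel_image:
  assumes "(step_rel Z g \<delta>)\<^sup>+\<^sup>+ x y"
    and "\<And>u v. u \<in> Z \<Longrightarrow> v \<in> Z \<Longrightarrow> dist (g u) v \<le> \<delta> \<Longrightarrow> h u \<in> Z \<and> h v \<in> Z \<and> dist (g (h u)) (h v) \<le> \<delta>'"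
  shows "(step_rel Z g \<delta>')\<^sup>+\<^sup>+ (h x) (h y)"
  using assms(1)
proof (induction rule: tranclp_induct)
  case (base y)
  then show ?case using assms(2)[of x y] by (auto simp: step_rel_def)
next
  case (step y z)
  then have "step_rel Z g \<delta>' (h y) (h z)" using assms(2)[of y z] by (auto simp: step_rel_def)
  then show ?case using step.IH by (rule tranclp.trancl_into_trancl[rotated])
qed

section \<open>Entropy\<close>

definition sep_growth :: "'a::metric_space set \<Rightarrow> ('a \<Rightarrow> 'a) \<Rightarrow> real \<Rightarrow> ereal" where
  "sep_growth Z g r = limsup (\<lambda>n. ereal (1 / real n * ln (real (max_separated Z g n r))))"

lemma separated_iff:
  assumes "n \<ge> 1"
  shows "separated g n r E \<longleftrightarrow>
    (\<forall>x\<in>E. \<forall>y\<in>E. x \<noteq> y \<longrightarrow> (\<exists>i<n. dist ((g ^^ i) x) ((g ^^ i) y) > r))"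
proof -
  have "{..<n} \<noteq> {}" using assms by (auto simp: lessThan_empty_iff)
  then have "Max ((\<lambda>i. dist ((g ^^ i) x) ((g ^^ i) y)) ` {..<n}) > r \<longleftrightarrow>
    (\<exists>i<n. dist ((g ^^ i) x) ((g ^^ i) y) > r)" for x y
    by (subst Max_gr_iff) auto
  then show ?thesis by (simp add: separated_def)
qed

lemma ln_of_nat_mono: "m \<le> n \<Longrightarrow> ln (real m) \<le> ln (real n)"
  by (cases "m = 0"; cases "n = 0") auto

lemma ln_of_nat_nonneg: "0 \<le> ln (real n)"
  using ln_of_nat_mono[of 0 n] by simp

context compact_homeo
begin

text \<open>
  By uniform continuity of the first \<open>n\<close> iterates, two distinct points of a separated set cannot be
  assigned to the same point of a fine enough finite net. This makes the maxima in the definition of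
  entropy genuine.
\<close>

lemma separated_card_bounded:
  assumes "0 < r" "n \<ge> 1"
  obtains B where "\<And>E. finite E \<Longrightarrow> separated f n r E \<Longrightarrow> card E \<le> B"
proof -
  have "\<exists>\<delta>>0. \<forall>i<k. \<forall>x y. dist x y \<le> \<delta> \<longrightarrow> dist ((f ^^ i) x) ((f ^^ i) y) \<le> r" for k
  proof (induction k)
    case 0
    show ?case by (auto intro: exI[of _ 1])
  next
    case (Suc k)
    obtain d where d: "d > 0" "\<And>i x y. i < k \<Longrightarrow> dist x y \<le> d \<Longrightarrow> dist ((f ^^ i) x) ((f ^^ i) y) \<le> r"
      using Suc by blast
    have "continuous_on UNIV (f ^^ k)"
      using continuous_iter_int[of "int k"] by (simp add: iter_int_def)
    then obtain d' where d': "d' > 0" "\<And>x y. dist x y \<le> d' \<Longrightarrow> dist ((f ^^ k) x) ((f ^^ k) y) \<le> r"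
      using uniform_continuity[OF _ assms(1)] by metis
    show ?case
      using d d' by (intro exI[of _ "min d d'"]) (auto simp: less_Suc_eq)
  qed
  then obtain \<delta> where \<delta>: "\<delta> > 0"
    "\<And>i x y. i < n \<Longrightarrow> dist x y \<le> \<delta> \<Longrightarrow> dist ((f ^^ i) x) ((f ^^ i) y) \<le> r"
    by metis
  obtain K :: "'a set" where K: "finite K" "\<And>x. \<exists>k\<in>K. dist x k \<le> \<delta> / 2"
    using finite_net[of "\<delta> / 2"] \<delta>(1) by (metis half_gt_zero)
  obtain c where c: "\<And>x. c x \<in> K" "\<And>x. dist x (c x) \<le> \<delta> / 2" using K(2) by metis
  show ?thesis
  proof (rule that[of "card K"])
    fix E assume E: "finite E" "separated f n r E"
    have "inj_on c E"
    proof (rule inj_onI, rule ccontr)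
      fix x y assume xy: "x \<in> E" "y \<in> E" "c x = c y" "x \<noteq> y"
      then obtain i where i: "i < n" "dist ((f ^^ i) x) ((f ^^ i) y) > r"
        using E(2) by (auto simp: separated_iff[OF assms(2)])
      have "dist x y \<le> \<delta>"
        using c(2)[of x] c(2)[of y] dist_triangle2[of x y "c x"] xy(3) by simp
      then show False using \<delta>(2)[OF i(1)] i(2) by force
    qed
    then show "card E \<le> card K" using card_inj_on_le[of c E K] c(1) K(1) by blast
  qed
qed

lemma finite_separated_cards:
  assumes "0 < r" "n \<ge> 1"
  shows "finite {card E | E. finite E \<and> E \<subseteq> Z \<and> separated f n r E}"
proof -
  obtain B where B: "\<And>E. finite E \<Longrightarrow> separated f n r E \<Longrightarrow> card E \<le> B"
    using separated_card_bounded[OF assms] by metis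
  have "{card E | E. finite E \<and> E \<subseteq> Z \<and> separated f n r E} \<subseteq> {..B}"
    using B by blast
  then show ?thesis by (rule finite_subset) simp
qed

lemma card_le_max_separated:
  assumes "0 < r" "n \<ge> 1" "finite E" "E \<subseteq> Z" "separated f n r E"
  shows "card E \<le> max_separated Z f n r"
  unfolding max_separated_def
  by (rule Max_ge[OF finite_separated_cards[OF assms(1,2)]]) (use assms(3-) in blast)

lemma max_separated_attained:
  assumes "0 < r" "n \<ge> 1"
  obtains E where "finite E" "E \<subseteq> Z" "separated f n r E" "max_separated Z f n r = card E"
proof -
  have "card ({} :: 'a set) \<in> {card E | E. finite E \<and> E \<subseteq> Z \<and> separated f n r E}"
    by (intro CollectI exI[of _ "{}"]) (simp add: separated_def)
  then have "max_separated Z f n r \<in> {card E | E. finite E \<and> E \<subseteq> Z \<and> separated f n r E}"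
    unfolding max_separated_def by (intro Max_in finite_separated_cards[OF assms]) blast
  then show ?thesis using that by blast
qed

lemma max_separated_mono:
  assumes "0 < r" "r \<le> r'" "n \<ge> 1" "Z \<subseteq> Z'"
  shows "max_separated Z f n r' \<le> max_separated Z' f n r"
proof -
  obtain E where E: "finite E" "E \<subseteq> Z" "separated f n r' E" "max_separated Z f n r' = card E"
    using max_separated_attained[of r' n Z] assms(1-3) by (metis less_le_trans)
  have "separated f n r E"
    using E(3) assms(2) unfolding separated_iff[OF assms(3)] by (meson le_less_trans)
  then show ?thesis
    using card_le_max_separated[OF assms(1,3) E(1), of Z'] E(2,4) assms(4) by simp
qed

lemma sep_growth_mono:
  assumes "0 < r" "r \<le> r'" "Z \<subseteq> Z'"
  shows "sep_growth Z f r' \<le> sep_growth Z' f r"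
  unfolding sep_growth_def
proof (rule Limsup_mono, rule eventually_mono[OF eventually_ge_at_top[of 1]])
  fix n :: nat assume "1 \<le> n"
  then have "ln (real (max_separated Z f n r')) \<le> ln (real (max_separated Z' f n r))"
    using max_separated_mono[OF assms(1,2) _ assms(3)] by (intro ln_of_nat_mono) auto
  then show "ereal (1 / real n * ln (real (max_separated Z f n r')))
      \<le> ereal (1 / real n * ln (real (max_separated Z' f n r)))"
    by (simp add: divide_right_mono)
qed

lemma sep_growth_nonneg: "0 \<le> sep_growth Z f r"
  unfolding sep_growth_def
  by (rule le_Limsup) (auto intro!: always_eventually simp: ln_of_nat_nonneg)

text \<open>
  The growth rate is antitone in the scale, so the limit at \<open>0\<close> exists and is the supremum.
\<close>

lemma topological_entropy_eq_SUP:
  "topological_entropy Z f = (SUP r\<in>{0<..}. sep_growth Z f r)"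
proof -
  have "((\<lambda>r. sep_growth Z f r) \<longlongrightarrow> (SUP r\<in>{0<..}. sep_growth Z f r)) (at_right 0)"
  proof (rule order_tendstoI)
    fix a assume "a < (SUP r\<in>{0<..}. sep_growth Z f r)"
    then obtain r where r: "0 < r" "a < sep_growth Z f r" by (auto simp: less_SUP_iff)
    have "a < sep_growth Z f s" if "0 < s" "s < r" for s
      using r(2) sep_growth_mono[of s r Z Z] that by (simp add: less_le_trans)
    then show "\<forall>\<^sub>F s in at_right 0. a < sep_growth Z f s"
      unfolding eventually_at_right_field using r(1) by blast
  next
    fix a assume a: "(SUP r\<in>{0<..}. sep_growth Z f r) < a"
    have "sep_growth Z f s < a" if "0 < s" for s
      using SUP_upper[of s "{0<..}" "sep_growth Z f"] that a by (simp add: le_less_trans)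
    then show "\<forall>\<^sub>F s in at_right 0. sep_growth Z f s < a"
      unfolding eventually_at_right_field using zero_less_one by blast
  qed
  then show ?thesis
    unfolding topological_entropy_def sep_growth_def[symmetric]
    by (intro tendsto_Lim) simp_all
qed

lemma topological_entropy_eq_0_iff:
  "topological_entropy Z f = 0 \<longleftrightarrow> (\<forall>r>0. sep_growth Z f r = 0)"
proof
  assume *: "topological_entropy Z f = 0"
  show "\<forall>r>0. sep_growth Z f r = 0"
  proof (intro allI impI)
    fix r :: real assume "0 < r"
    then have "sep_growth Z f r \<le> 0"
      using SUP_upper[of r "{0<..}" "sep_growth Z f"] * by (simp add: topological_entropy_eq_SUP)
    then show "sep_growth Z f r = 0" using sep_growth_nonneg[of Z r] by simp
  qed
next
  assume "\<forall>r>0. sep_growth Z f r = 0"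
  then have "(SUP r\<in>{0<..}. sep_growth Z f r) = (SUP r::real\<in>{0<..}. 0)"
    by (intro SUP_cong) auto
  also have "\<dots> = 0" by (rule SUP_const) auto
  finally show "topological_entropy Z f = 0" by (simp add: topological_entropy_eq_SUP)
qed

lemma topological_entropy_0_subset:
  assumes "Z \<subseteq> Z'" "topological_entropy Z' f = 0"
  shows "topological_entropy Z f = 0"
  unfolding topological_entropy_eq_0_iff
proof (intro allI impI)
  fix r :: real assume r: "0 < r"
  then have "sep_growth Z f r \<le> 0"
    using sep_growth_mono[OF r order_refl assms(1)] assms(2)
    by (simp add: topological_entropy_eq_0_iff)
  then show "sep_growth Z f r = 0" using sep_growth_nonneg[of Z r] by simp
qed

text \<open>
  Exponential growth along the multiples of \<open>m\<close> already bounds the upper limit below by \<open>ln 2 / m\<close>.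
\<close>

lemma topological_entropy_nonzero:
  assumes "0 < r" "m \<ge> 1" "\<And>n. n \<ge> 1 \<Longrightarrow> 2 ^ n \<le> max_separated Z f (m * n) r"
  shows "topological_entropy Z f \<noteq> 0"
proof
  assume 0: "topological_entropy Z f = 0"
  let ?a = "\<lambda>n. ereal (1 / real n * ln (real (max_separated Z f n r)))"
  have "ereal (ln 2 / m) \<le> limsup (?a \<circ> (*) m)"
  proof (rule le_Limsup)
    show "\<forall>\<^sub>F n in sequentially. ereal (ln 2 / m) \<le> (?a \<circ> (*) m) n"
    proof (rule eventually_mono[OF eventually_ge_at_top[of 1]])
      fix n :: nat assume n: "1 \<le> n"
      have "real n * ln 2 = ln (real (2 ^ n))" by (simp add: ln_realpow)
      also have "\<dots> \<le> ln (real (max_separated Z f (m * n) r))"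
        by (rule ln_of_nat_mono) (rule assms(3)[OF n])
      finally have "1 / real (m * n) * (real n * ln 2) \<le> 1 / real (m * n) * ln (real (max_separated Z f (m * n) r))"
        by (intro mult_left_mono) auto
      then show "ereal (ln 2 / m) \<le> (?a \<circ> (*) m) n" using n by simp
    qed
  qed simp
  also have "\<dots> \<le> limsup ?a"
    by (rule limsup_subseq_mono) (use assms(2) in \<open>auto simp: strict_mono_def\<close>)
  also have "\<dots> = 0"
    using 0 assms(1) by (simp add: topological_entropy_eq_0_iff sep_growth_def)
  finally show False using assms(2) by (simp add: divide_le_0_iff)
qed

lemma sep_growth_eq_0I:
  assumes "0 < r"
    and "\<And>n E. n \<ge> 1 \<Longrightarrow> finite E \<Longrightarrow> E \<subseteq> Z \<Longrightarrow> separated f n r E \<Longrightarrow> card E \<le> C * n ^ M"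
  shows "sep_growth Z f r = 0"
proof -
  let ?a = "\<lambda>n. 1 / real n * ln (real (max_separated Z f n r))"
  have "(\<lambda>n. ln (real (Suc C)) * (1 / real n) + real M * (ln (real n) / real n))
      \<longlonglongrightarrow> ln (real (Suc C)) * 0 + real M * 0"
    by (intro tendsto_intros lim_ln_over_n lim_1_over_n)
  then have lim: "(\<lambda>n. ln (real (Suc C)) * (1 / real n) + real M * (ln (real n) / real n)) \<longlonglongrightarrow> 0"
    by simp
  have "?a \<longlonglongrightarrow> 0"
  proof (rule tendsto_sandwich[OF _ _ tendsto_const lim])
    show "\<forall>\<^sub>F n in sequentially. 0 \<le> ?a n"
      by (simp add: ln_of_nat_nonneg)
    show "\<forall>\<^sub>F n in sequentially. ?a n \<le> ln (real (Suc C)) * (1 / real n) + real M * (ln (real n) / real n)"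
    proof (rule eventually_mono[OF eventually_ge_at_top[of 1]])
      fix n :: nat assume n: "1 \<le> n"
      obtain E where "finite E" "E \<subseteq> Z" "separated f n r E" "max_separated Z f n r = card E"
        using max_separated_attained[OF assms(1) n] by blast
      then have "max_separated Z f n r \<le> C * n ^ M" using assms(2)[OF n] by simp
      also have "\<dots> \<le> Suc C * n ^ M" by simp
      finally have "ln (real (max_separated Z f n r)) \<le> ln (real (Suc C * n ^ M))"
        by (rule ln_of_nat_mono)
      also have "\<dots> = ln (real (Suc C)) + real M * ln (real n)"
        using n by (simp add: ln_mult ln_realpow del: of_nat_Suc mult_Suc)
      finally show "?a n \<le> ln (real (Suc C)) * (1 / real n) + real M * (ln (real n) / real n)"
        using n by (simp add: field_simps del: of_nat_Suc)
    qed
  qed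
  then have "(\<lambda>n. ereal (?a n)) \<longlonglongrightarrow> ereal 0" by (rule tendsto_ereal)
  then have "limsup (\<lambda>n. ereal (?a n)) = ereal 0"
    by (intro lim_imp_Limsup) simp_all
  then show ?thesis by (simp add: sep_growth_def)
qed


section \<open>The chain recurrent set\<close>

text \<open>
  Moving the base point of a loop changes both its first and its last step; this is the reason why
  chain recurrence is a closed condition and why non-recurrence is witnessed by a \<open>\<delta>\<close> that works
  in a neighbourhood.
\<close>

lemma loops_stable:
  assumes "x \<in> \<Lambda>" "0 < \<delta>"
  obtains \<eta> where "0 < \<eta>"
    "\<And>y. dist y x \<le> \<eta> \<Longrightarrow> (step_rel \<Lambda> f \<eta>)\<^sup>+\<^sup>+ y y \<Longrightarrow> (step_rel \<Lambda> f \<delta>)\<^sup>+\<^sup>+ x x"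
proof -
  obtain \<eta> where \<eta>: "0 < \<eta>" "\<eta> \<le> \<delta> / 3" "\<And>u v. dist u v \<le> \<eta> \<Longrightarrow> dist (f u) (f v) \<le> \<delta> / 3"
    using uniform_continuity[OF continuous_f, of "\<delta> / 3"] assms(2) by auto
  show ?thesis
  proof (rule that[OF \<eta>(1)])
    fix y assume y: "dist y x \<le> \<eta>" "(step_rel \<Lambda> f \<eta>)\<^sup>+\<^sup>+ y y"
    have "(step_rel \<Lambda> f (\<eta> + \<delta> / 3))\<^sup>+\<^sup>+ x y"
      by (rule step_rel_change_start[OF y(2)]) (use \<eta>(3)[of x y] y(1) assms in \<open>auto simp: dist_commute\<close>)
    then have "(step_rel \<Lambda> f (\<eta> + \<delta> / 3 + \<eta>))\<^sup>+\<^sup>+ x x"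
      by (rule step_rel_change_end) (use y(1) assms(1) \<eta>(1) in auto)
    then show "(step_rel \<Lambda> f \<delta>)\<^sup>+\<^sup>+ x x"
      by (rule tranclp_step_rel_mono[rotated]) (use \<eta>(2) in auto)
  qed
qed

lemma closed_chain_recurrent_set:
  assumes "closed \<Lambda>"
  shows "closed (chain_recurrent_set \<Lambda> f)"
proof -
  have "x \<in> chain_recurrent_set \<Lambda> f" if cl: "x \<in> closure (chain_recurrent_set \<Lambda> f)" for x
    unfolding chain_recurrent_set_iff
  proof (intro conjI allI impI)
    have "closure (chain_recurrent_set \<Lambda> f) \<subseteq> \<Lambda>"
      by (rule closure_minimal[OF _ assms]) (auto simp: chain_recurrent_set_def)
    then show x: "x \<in> \<Lambda>" using cl by blast
    fix \<delta> :: real assume "0 < \<delta>"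
    then obtain \<eta> where \<eta>: "0 < \<eta>"
      "\<And>y. dist y x \<le> \<eta> \<Longrightarrow> (step_rel \<Lambda> f \<eta>)\<^sup>+\<^sup>+ y y \<Longrightarrow> (step_rel \<Lambda> f \<delta>)\<^sup>+\<^sup>+ x x"
      using loops_stable[OF x] by metis
    obtain y where "y \<in> chain_recurrent_set \<Lambda> f" "dist y x < \<eta>"
      using cl \<eta>(1) unfolding closure_approachable by blast
    then show "(step_rel \<Lambda> f \<delta>)\<^sup>+\<^sup>+ x x"
      using \<eta>(1) \<eta>(2)[of y] by (simp add: chain_recurrent_set_iff)
  qed
  then show ?thesis using closure_subset_eq by blast
qed

text \<open>
  A map that commutes with \<open>f\<close> sends fine chains to fine chains. It is used for \<open>f\<close> and for its inverse.
\<close>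

lemma chain_recurrent_image:
  assumes "continuous_on UNIV h" "\<And>u. h (f u) = f (h u)" "\<And>u. u \<in> \<Lambda> \<Longrightarrow> h u \<in> \<Lambda>"
    and "x \<in> chain_recurrent_set \<Lambda> f"
  shows "h x \<in> chain_recurrent_set \<Lambda> f"
  unfolding chain_recurrent_set_iff
proof (intro conjI allI impI)
  show "h x \<in> \<Lambda>" using assms(3,4) by (simp add: chain_recurrent_set_iff)
  fix \<delta> :: real assume "0 < \<delta>"
  then obtain \<eta> where \<eta>: "0 < \<eta>" "\<eta> \<le> \<delta>" "\<And>u v. dist u v \<le> \<eta> \<Longrightarrow> dist (h u) (h v) \<le> \<delta>"
    using uniform_continuity[OF assms(1), of \<delta>] by auto
  have "(step_rel \<Lambda> f \<eta>)\<^sup>+\<^sup>+ x x" using assms(4) \<eta>(1) by (simp add: chain_recurrent_set_iff)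
  then show "(step_rel \<Lambda> f \<delta>)\<^sup>+\<^sup>+ (h x) (h x)"
  proof (rule step_rel_image)
    fix u v assume "u \<in> \<Lambda>" "v \<in> \<Lambda>" "dist (f u) v \<le> \<eta>"
    then show "h u \<in> \<Lambda> \<and> h v \<in> \<Lambda> \<and> dist (f (h u)) (h v) \<le> \<delta>"
      using \<eta>(3)[of "f u" v] assms(2)[of u] assms(3) by simp
  qed
qed

lemma image_chain_recurrent_set:
  assumes "f ` \<Lambda> = \<Lambda>"
  shows "f ` chain_recurrent_set \<Lambda> f = chain_recurrent_set \<Lambda> f"
proof (intro equalityI subsetI)
  fix x assume "x \<in> f ` chain_recurrent_set \<Lambda> f"
  then show "x \<in> chain_recurrent_set \<Lambda> f"
    using chain_recurrent_image[OF continuous_f] assms by blast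
next
  fix x assume x: "x \<in> chain_recurrent_set \<Lambda> f"
  have "inv f u \<in> \<Lambda>" if "u \<in> \<Lambda>" for u
    using that assms by (metis imageE inv_f)
  then have "inv f x \<in> chain_recurrent_set \<Lambda> f"
    by (intro chain_recurrent_image[OF continuous_inv_f _ _ x]) auto
  then show "x \<in> f ` chain_recurrent_set \<Lambda> f" by (metis f_inv image_eqI)
qed

text \<open>
  For one iterate: take a finer loop \<open>u, v, \<dots>, u\<close>. Its second point \<open>v\<close> is close to \<open>f u\<close>, so the rest of
  the loop can be started at \<open>f u\<close> instead. All iterates are chain recurrent again, which allows
  induction.
\<close>

lemma chain_from_iterate:
  assumes "f ` \<Lambda> = \<Lambda>" "x \<in> chain_recurrent_set \<Lambda> f" "0 < \<delta>"
  shows "(step_rel \<Lambda> f \<delta>)\<^sup>+\<^sup>+ ((f ^^ i) x) x"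
proof -
  have step: "(step_rel \<Lambda> f \<delta>)\<^sup>+\<^sup>+ (f u) u" if u: "u \<in> chain_recurrent_set \<Lambda> f" for u
  proof -
    obtain \<eta> where \<eta>: "0 < \<eta>" "\<eta> \<le> \<delta> / 2" "\<And>u v. dist u v \<le> \<eta> \<Longrightarrow> dist (f u) (f v) \<le> \<delta> / 2"
      using uniform_continuity[OF continuous_f, of "\<delta> / 2"] assms(3) by auto
    have u\<Lambda>: "f u \<in> \<Lambda>" and uu: "(step_rel \<Lambda> f \<eta>)\<^sup>+\<^sup>+ u u"
      using u \<eta>(1) assms(1) by (auto simp: chain_recurrent_set_iff)
    obtain v where v: "step_rel \<Lambda> f \<eta> u v" "(step_rel \<Lambda> f \<eta>)\<^sup>*\<^sup>* v u"
      using uu by (metis tranclpD)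
    have "(step_rel \<Lambda> f \<eta>)\<^sup>+\<^sup>+ v u"
      using rtranclpD[OF v(2)] uu by auto
    then have "(step_rel \<Lambda> f (\<eta> + \<delta> / 2))\<^sup>+\<^sup>+ (f u) u"
      by (rule step_rel_change_start)
        (use v(1) \<eta>(3)[of "f u" v] u\<Lambda> assms(3) in \<open>auto simp: step_rel_def\<close>)
    then show ?thesis
      by (rule tranclp_step_rel_mono[rotated]) (use \<eta>(2) in auto)
  qed
  have CR: "(f ^^ i) x \<in> chain_recurrent_set \<Lambda> f" for i
    using image_chain_recurrent_set[OF assms(1)] assms(2) by (induction i) auto
  show ?thesis
  proof (induction i)
    case 0
    show ?case using assms(2,3) by (simp add: chain_recurrent_set_iff)
  next
    case (Suc i)
    then show ?case using tranclp_trans[OF step[OF CR[of i]] Suc] by simp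
  qed
qed

text \<open>
  The loop follows the orbit of \<open>x\<close> without error up to time \<open>i\<close> and then takes a chain back to \<open>x\<close>. It is
  extended periodically, so that two loops of different lengths can be run for a common multiple of
  their periods.
\<close>

lemma periodic_chain_through_orbit:
  assumes "f ` \<Lambda> = \<Lambda>" "x \<in> chain_recurrent_set \<Lambda> f" "0 < \<delta>"
  obtains k g where "i < k" "\<And>q. g (q * k) = x" "g i = (f ^^ i) x"
    "\<And>j. g j \<in> \<Lambda>" "\<And>j. dist (f (g j)) (g (Suc j)) \<le> \<delta>"
proof -
  obtain l where l: "l > 0" "(step_rel \<Lambda> f \<delta> ^^ l) ((f ^^ i) x) x"
    using chain_from_iterate[OF assms] by (auto simp: tranclp_power)
  then obtain c where c: "c 0 = (f ^^ i) x" "c l = x" "\<And>j. j < l \<Longrightarrow> step_rel \<Lambda> f \<delta> (c j) (c (Suc j))"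
    by (auto simp: relpowp_fun_conv)
  define k where "k = i + l"
  define h where "h j = (if j \<le> i then (f ^^ j) x else c (j - i))" for j
  have orbit: "(f ^^ j) x \<in> \<Lambda>" for j
    using iter_int_in_invariant[OF assms(1), of x "int j"] assms(2)
    by (simp add: chain_recurrent_set_iff iter_int_of_nat)
  have hc: "h j = c (j - i)" if "i \<le> j" for j
    using that c(1) by (auto simp: h_def)
  have step: "h j \<in> \<Lambda> \<and> dist (f (h j)) (h (Suc j)) \<le> \<delta>" if "j < k" for j
  proof (cases "j < i")
    case True
    then show ?thesis using orbit assms(3) by (simp add: h_def)
  next
    case False
    then have "h j = c (j - i)" "h (Suc j) = c (Suc (j - i))" "j - i < l"
      using hc[of j] hc[of "Suc j"] that by (auto simp: k_def Suc_diff_le)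
    then show ?thesis using c(3) by (simp add: step_rel_def)
  qed
  have k: "0 < k" "i < k" using l(1) by (auto simp: k_def)
  have hk: "h 0 = x" "h k = x" using hc[of k] c(2) by (auto simp: h_def k_def)
  show ?thesis
  proof (rule that[of k "\<lambda>j. h (j mod k)"])
    fix j
    show "h (j mod k) \<in> \<Lambda>" using step k(1) by simp
    have "h (Suc j mod k) = h (Suc (j mod k))"
      using hk by (simp add: mod_Suc)
    then show "dist (f (h (j mod k))) (h (Suc j mod k)) \<le> \<delta>" using step[of "j mod k"] k(1) by simp
  qed (use k hk in \<open>auto simp: h_def\<close>)
qed

section \<open>Sensitivity produces a horseshoe\<close>

text \<open>
  The two loops at \<open>x\<close> and \<open>y\<close> differ by more than \<open>a\<close> at the time \<open>i\<close>. Points that \<open>a / 4\<close>-shadow two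
  concatenations which disagree in some block therefore differ by more than \<open>a / 2\<close> at the corresponding
  time.
\<close>

lemma sensitive_imp_entropy_nonzero:
  assumes "f ` \<Lambda> = \<Lambda>" "shadowing_on f \<Lambda>"
    and "sensitive_points (chain_recurrent_set \<Lambda> f) f \<noteq> {}" "0 < \<epsilon>"
  shows "topological_entropy (invariant_part f (closed_nbhd \<epsilon> \<Lambda>)) f \<noteq> 0"
proof -
  obtain x a where a: "0 < a" and "x \<in> sensitive_points_at a (chain_recurrent_set \<Lambda> f) f"
    using assms(3) by (auto simp: sensitive_points_def)
  then have x: "x \<in> chain_recurrent_set \<Lambda> f"
    and sens: "\<And>\<delta>. 0 < \<delta> \<Longrightarrow> \<exists>y\<in>chain_recurrent_set \<Lambda> f. dist x y \<le> \<delta> \<and>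
      (\<exists>i. dist ((f ^^ i) x) ((f ^^ i) y) > a)"
    by (auto simp: sensitive_points_at_def)
  define \<epsilon>' where "\<epsilon>' = min \<epsilon> (a / 4)"
  have \<epsilon>': "0 < \<epsilon>'" "\<epsilon>' \<le> \<epsilon>" "\<epsilon>' \<le> a / 4" using assms(4) a by (auto simp: \<epsilon>'_def)
  obtain \<delta> where \<delta>: "0 < \<delta>"
    "\<And>s. pseudo_orbit f \<delta> s \<Longrightarrow> (\<And>i. s i \<in> \<Lambda>) \<Longrightarrow> \<exists>z. shadowed_by f \<epsilon>' s z"
    using assms(2) \<epsilon>'(1) unfolding shadowing_on_def by metis
  obtain y i where y: "y \<in> chain_recurrent_set \<Lambda> f" "dist x y \<le> \<delta> / 2"
    and i: "dist ((f ^^ i) x) ((f ^^ i) y) > a"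
    using sens[of "\<delta> / 2"] \<delta>(1) by auto
  obtain k g where g: "i < k" "\<And>q. g (q * k) = x" "g i = (f ^^ i) x"
    "\<And>j. g j \<in> \<Lambda>" "\<And>j. dist (f (g j)) (g (Suc j)) \<le> \<delta> / 2"
    using periodic_chain_through_orbit[OF assms(1) x, of "\<delta> / 2" i] \<delta>(1) by (metis half_gt_zero)
  obtain l h where h: "i < l" "\<And>q. h (q * l) = y" "h i = (f ^^ i) y"
    "\<And>j. h j \<in> \<Lambda>" "\<And>j. dist (f (h j)) (h (Suc j)) \<le> \<delta> / 2"
    using periodic_chain_through_orbit[OF assms(1) y(1), of "\<delta> / 2" i] \<delta>(1) by (metis half_gt_zero)
  define m where "m = k * l"
  have kl: "0 < k" "0 < l" using g(1) h(1) by auto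
  have "k * 1 \<le> k * l" using kl by (intro mult_le_mono) auto
  then have "k \<le> m" by (simp add: m_def)
  then have m: "i < m" "0 < m" using g(1) by auto
  have gm: "g 0 = x" "g m = x" "h 0 = y" "h m = y"
    using g(2)[of 0] g(2)[of l] h(2)[of 0] h(2)[of k] by (simp_all add: m_def mult.commute)
  \<comment> \<open>The pseudo orbit that runs through the loop of \<open>x\<close> in the blocks listed in \<open>S\<close>
      and through the loop of \<open>y\<close> in all others.\<close>
  define s :: "nat set \<Rightarrow> int \<Rightarrow> 'a"
    where "s S t = (if t div int m \<in> int ` S then g else h) (nat (t mod int m))" for S t
  have s_in: "s S t \<in> \<Lambda>" for S t using g(4) h(4) by (simp add: s_def)
  have s_pseudo: "pseudo_orbit f \<delta> (s S)" for S
    unfolding pseudo_orbit_def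
  proof
    fix t :: int
    define q j where "q = t div int m" and "j = nat (t mod int m)"
    have j: "j < m" using m(2) by (simp add: j_def nat_less_iff)
    have t: "t = q * int m + int j" using m(2) by (simp add: q_def j_def)
    define w where "w = (if q \<in> int ` S then g else h)"
    have st: "s S t = w j" by (simp add: s_def w_def q_def j_def)
    have wj: "dist (f (w j)) (w (Suc j)) \<le> \<delta> / 2" using g(5) h(5) by (simp add: w_def)
    show "dist (f (s S t)) (s S (t + 1)) \<le> \<delta>"
    proof (cases "Suc j < m")
      case True
      have *: "t + 1 = int (Suc j) + q * int m" using t by simp
      have "(t + 1) div int m = q" "(t + 1) mod int m = int (Suc j)"
        unfolding * using True by (simp_all del: of_nat_Suc)
      then have "s S (t + 1) = w (Suc j)" by (simp add: s_def w_def del: of_nat_Suc)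
      then show ?thesis using wj st \<delta>(1) by simp
    next
      case False
      \<comment> \<open>At the end of a block the next loop may start at the other base point, which
          costs \<open>dist x y\<close>.\<close>
      then have jm: "Suc j = m" using j by simp
      then have "t + 1 = (q + 1) * int m" using t by (simp add: algebra_simps flip: of_nat_Suc)
      then have "(t + 1) mod int m = 0" by simp
      then have "s S (t + 1) \<in> {x, y}" using gm by (simp add: s_def)
      moreover have "w m \<in> {x, y}" using gm by (simp add: w_def)
      ultimately have "dist (w m) (s S (t + 1)) \<le> \<delta> / 2"
        using y(2) \<delta>(1) by (auto simp: dist_commute)
      then show ?thesis
        using wj jm st dist_triangle[of "f (w j)" "s S (t + 1)" "w m"] by simp
    qed
  qed
  obtain z where z: "\<And>S. shadowed_by f \<epsilon>' (s S) (z S)"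
    using \<delta>(2)[OF s_pseudo s_in] by metis
  have z_in: "z S \<in> invariant_part f (closed_nbhd \<epsilon> \<Lambda>)" for S
    unfolding invariant_part_iff
  proof
    fix t
    have "dist (s S t) (iter_int f t (z S)) \<le> \<epsilon>'" using z[of S] by (simp add: shadowed_by_def)
    then show "iter_int f t (z S) \<in> closed_nbhd \<epsilon> \<Lambda>"
      using \<epsilon>'(2) by (intro closed_nbhdI[OF s_in[of S t]]) (simp add: dist_commute)
  qed
  have apart: "\<exists>t < m * n. dist ((f ^^ t) (z S)) ((f ^^ t) (z T)) > a / 2"
    if ST: "S \<subseteq> {..<n}" "T \<subseteq> {..<n}" "S \<noteq> T" for S T n
  proof -
    obtain q where q: "q < n" "q \<in> S \<longleftrightarrow> q \<notin> T" using ST by blast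
    define t where "t = q * m + i"
    have "t < q * m + m" using m(1) by (simp add: t_def)
    also have "\<dots> \<le> m * n" using mult_le_mono2[of "Suc q" n m] q(1) by (simp add: mult.commute)
    finally have t: "t < m * n" .
    have "int t div int m = int q" "int t mod int m = int i"
      using m by (simp_all add: t_def flip: of_nat_div of_nat_mod)
    then have s: "s U (int t) = (if q \<in> U then (f ^^ i) x else (f ^^ i) y)" for U
      using g(3) h(3) by (auto simp: s_def)
    have far: "dist (s S (int t)) (s T (int t)) > a"
      using q(2) i by (auto simp: s dist_commute)
    have sh: "dist (s U (int t)) ((f ^^ t) (z U)) \<le> a / 4" for U
    proof -
      have "dist (s U (int t)) (iter_int f (int t) (z U)) \<le> \<epsilon>'"
        using z[of U] by (simp add: shadowed_by_def)
      then show ?thesis using \<epsilon>'(3) by (simp add: iter_int_of_nat)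
    qed
    have "dist (s S (int t)) (s T (int t)) \<le> dist (s S (int t)) ((f ^^ t) (z S))
        + dist ((f ^^ t) (z S)) ((f ^^ t) (z T)) + dist (s T (int t)) ((f ^^ t) (z T))"
      using dist_triangle[of "s S (int t)" "s T (int t)" "(f ^^ t) (z S)"]
        dist_triangle[of "(f ^^ t) (z S)" "s T (int t)" "(f ^^ t) (z T)"]
        dist_commute[of "s T (int t)" "(f ^^ t) (z T)"] by linarith
    then have "dist ((f ^^ t) (z S)) ((f ^^ t) (z T)) > a / 2" using far sh[of S] sh[of T] by linarith
    then show ?thesis using t by blast
  qed
  show ?thesis
  proof (rule topological_entropy_nonzero)
    show "0 < a / 2" using a by simp
    show "1 \<le> m" using m(2) by simp
    fix n :: nat assume n: "1 \<le> n"
    have mn: "1 \<le> m * n" using m(2) n by (simp add: Suc_le_eq)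
    have inj: "inj_on z (Pow {..<n})"
    proof (rule inj_onI, rule ccontr)
      fix S T assume ST: "S \<in> Pow {..<n}" "T \<in> Pow {..<n}" "z S = z T" "S \<noteq> T"
      then show False using apart[of S n T] a by simp
    qed
    have "separated f (m * n) (a / 2) (z ` Pow {..<n})"
      unfolding separated_iff[OF mn]
    proof (intro ballI impI)
      fix u v assume "u \<in> z ` Pow {..<n}" "v \<in> z ` Pow {..<n}" "u \<noteq> v"
      then obtain S T where "S \<subseteq> {..<n}" "T \<subseteq> {..<n}" "S \<noteq> T" "u = z S" "v = z T" by blast
      then show "\<exists>t < m * n. a / 2 < dist ((f ^^ t) u) ((f ^^ t) v)" using apart by blast
    qed
    then have "card (z ` Pow {..<n}) \<le> max_separated (invariant_part f (closed_nbhd \<epsilon> \<Lambda>)) f (m * n) (a / 2)"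
      using a mn z_in by (intro card_le_max_separated) auto
    then show "2 ^ n \<le> max_separated (invariant_part f (closed_nbhd \<epsilon> \<Lambda>)) f (m * n) (a / 2)"
      by (simp add: card_image[OF inj] card_Pow)
  qed
qed


section \<open>Finiteness of expansive systems without sensitivity\<close>

definition separates_orbits :: "real \<Rightarrow> 'a set \<Rightarrow> bool" where
  "separates_orbits e Y \<longleftrightarrow>
     (\<forall>x\<in>Y. \<forall>y\<in>Y. (\<forall>i. dist (iter_int f i x) (iter_int f i y) \<le> e) \<longrightarrow> x = y)"

lemma separates_orbitsD:
  "separates_orbits e Y \<Longrightarrow> x \<in> Y \<Longrightarrow> y \<in> Y \<Longrightarrow>
    (\<And>i. dist (iter_int f i x) (iter_int f i y) \<le> e) \<Longrightarrow> x = y"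
  by (auto simp: separates_orbits_def)

lemma separates_orbits_subset: "separates_orbits e Y \<Longrightarrow> Y' \<subseteq> Y \<Longrightarrow> separates_orbits e Y'"
  by (auto simp: separates_orbits_def)

lemma expansive_on_iff_separates_orbits:
  "expansive_on f S \<longleftrightarrow> (\<exists>e>0. separates_orbits e (invariant_part f S))"
  by (simp add: expansive_on_def separates_orbits_def SUP_le_iff)

text \<open>
  Without sensitivity, \<open>Z\<close> has a finite cover by sets whose points stay \<open>e\<close>-close at all positive times.
  Suppose that \<open>Z\<close> has more points than the cover has sets. Pull finitely many of them back by \<open>n\<close> steps: two
  land in the same set, so these two are \<open>e\<close>-close at all times \<open>\<ge> - n\<close>. One pair occurs for infinitely
  many \<open>n\<close>, hence is \<open>e\<close>-close at all times, contradicting expansivity.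
\<close>

lemma insensitive_expansive_finite:
  assumes "closed Z" "f ` Z = Z" "sensitive_points Z f = {}" "0 < e" "separates_orbits e Z"
  shows "finite Z"
proof -
  have "\<exists>d>0. \<forall>y\<in>Z. dist x y \<le> d \<longrightarrow> (\<forall>i. dist ((f ^^ i) x) ((f ^^ i) y) \<le> e / 2)" if "x \<in> Z" for x
  proof -
    have "x \<notin> sensitive_points_at (e / 2) Z f"
      using assms(3,4) by (auto simp: sensitive_points_def)
    then show ?thesis using that by (auto simp: sensitive_points_at_def not_less)
  qed
  then obtain d where d: "\<And>x. x \<in> Z \<Longrightarrow> d x > 0"
    "\<And>x y i. x \<in> Z \<Longrightarrow> y \<in> Z \<Longrightarrow> dist x y \<le> d x \<Longrightarrow> dist ((f ^^ i) x) ((f ^^ i) y) \<le> e / 2"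
    by metis
  obtain C where C: "C \<subseteq> Z" "finite C" "Z \<subseteq> (\<Union>x\<in>C. ball x (d x))"
  proof (rule compactE_image[OF closed_imp_compact[OF assms(1)], of Z "\<lambda>x. ball x (d x)"])
    show "Z \<subseteq> (\<Union>x\<in>Z. ball x (d x))" using d(1) by force
  qed auto
  have "\<exists>c\<in>C. dist c y \<le> d c" if "y \<in> Z" for y
    using C(3) that by (force simp: less_imp_le)
  then obtain c where c: "\<And>y. y \<in> Z \<Longrightarrow> c y \<in> C" "\<And>y. y \<in> Z \<Longrightarrow> dist (c y) y \<le> d (c y)"
    by metis
  show ?thesis
  proof (rule ccontr)
    assume "infinite Z"
    then obtain F where F: "finite F" "card F = Suc (card C)" "F \<subseteq> Z"
      using infinite_arbitrarily_large by blast
    have "\<exists>p\<in>F \<times> F. fst p \<noteq> snd p \<and> c (iter_int f (- int n) (fst p)) = c (iter_int f (- int n) (snd p))" for n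
    proof -
      have "(\<lambda>z. c (iter_int f (- int n) z)) ` F \<subseteq> C"
        using F(3) c(1) iter_int_in_invariant[OF assms(2)] by blast
      then have "card ((\<lambda>z. c (iter_int f (- int n) z)) ` F) < card F"
        using card_mono[OF C(2)] F(2) by (simp add: less_Suc_eq_le)
      then have "\<not> inj_on (\<lambda>z. c (iter_int f (- int n) z)) F"
        by (rule pigeonhole)
      then show ?thesis unfolding inj_on_def by fastforce
    qed
    then obtain p where p: "\<And>n. p n \<in> F \<times> F" "\<And>n. fst (p n) \<noteq> snd (p n)"
      "\<And>n. c (iter_int f (- int n) (fst (p n))) = c (iter_int f (- int n) (snd (p n)))"
      by metis
    have "finite (range p)"
    proof (rule finite_subset)
      show "range p \<subseteq> F \<times> F" using p(1) by blast
    qed (use F(1) in simp)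
    then obtain n0 where n0: "infinite {n. p n = p n0}"
      using pigeonhole_infinite[of UNIV p] by auto
    define u v where "u = fst (p n0)" and "v = snd (p n0)"
    have uv: "u \<in> Z" "v \<in> Z" using p(1)[of n0] F(3) by (auto simp: u_def v_def mem_Times_iff)
    have "u = v"
    proof (rule separates_orbitsD[OF assms(5) uv])
      fix i :: int
      obtain n where n: "nat (- i) \<le> n" "p n = p n0"
        using n0 unfolding infinite_nat_iff_unbounded_le by blast
      define u' v' k where "u' = iter_int f (- int n) u" and "v' = iter_int f (- int n) v"
        and "k = nat (i + int n)"
      have i: "i = int k + (- int n)" using n(1) by (simp add: k_def)
      have uv': "u' \<in> Z" "v' \<in> Z" using iter_int_in_invariant[OF assms(2)] uv by (auto simp: u'_def v'_def)
      have "c u' = c v'" using p(3)[of n] n(2) by (simp add: u'_def v'_def u_def v_def)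
      then have "dist ((f ^^ k) (c u')) ((f ^^ k) u') \<le> e / 2" "dist ((f ^^ k) (c u')) ((f ^^ k) v') \<le> e / 2"
        using d(2)[of "c u'" u' k] d(2)[of "c v'" v' k] c[OF uv'(1)] c[OF uv'(2)] uv' C(1) by auto
      then have "dist ((f ^^ k) u') ((f ^^ k) v') \<le> e"
        using dist_triangle3[of "(f ^^ k) u'" "(f ^^ k) v'" "(f ^^ k) (c u')"] by linarith
      then show "dist (iter_int f i u) (iter_int f i v) \<le> e"
        by (simp only: i iter_int_add) (simp add: u'_def v'_def iter_int_of_nat)
    qed
    then show False using p(2)[of n0] by (simp add: u_def v_def)
  qed
qed

text \<open>
  Otherwise a limit of pairs that stay \<open>e\<close>-close for longer and longer but are \<open>r\<close>-apart would
  contradict expansivity. This allows entropy at every scale to be computed at the scale \<open>e\<close>, at the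
  price of lengthening the orbit by \<open>2 * N\<close>.
\<close>

lemma uniform_expansivity:
  assumes "closed Y" "0 < r" "separates_orbits e Y"
  obtains N :: nat where "\<And>x y. x \<in> Y \<Longrightarrow> y \<in> Y \<Longrightarrow>
    (\<And>k. \<bar>k\<bar> \<le> int N \<Longrightarrow> dist (iter_int f k x) (iter_int f k y) \<le> e) \<Longrightarrow> dist x y \<le> r"
proof (rule ccontr)
  assume "\<not> thesis"
  then have "\<forall>N. \<exists>q. q \<in> Y \<times> Y \<and>
      (\<forall>k. \<bar>k\<bar> \<le> int N \<longrightarrow> dist (iter_int f k (fst q)) (iter_int f k (snd q)) \<le> e) \<and> dist (fst q) (snd q) > r"
    using that by (force simp: not_le)
  then obtain q where q: "\<And>N. q N \<in> Y \<times> Y" "\<And>N. dist (fst (q N)) (snd (q N)) > r"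
    "\<And>N k. \<bar>k\<bar> \<le> int N \<Longrightarrow> dist (iter_int f k (fst (q N))) (iter_int f k (snd (q N))) \<le> e"
    by metis
  have "compact (Y \<times> Y)" using closed_imp_compact[OF assms(1)] by (simp add: compact_Times)
  then obtain l s where l: "l \<in> Y \<times> Y" and s: "strict_mono (s :: nat \<Rightarrow> nat)" "(q \<circ> s) \<longlonglongrightarrow> l"
    using q(1) unfolding compact_def by metis
  have lim: "(\<lambda>n. dist (iter_int f k (fst (q (s n)))) (iter_int f k (snd (q (s n)))))
      \<longlonglongrightarrow> dist (iter_int f k (fst l)) (iter_int f k (snd l))" for k
  proof -
    have cont: "isCont (iter_int f k) a" for a
      using continuous_iter_int[of k] by (simp add: continuous_on_eq_continuous_at)
    have "(\<lambda>n. q (s n)) \<longlonglongrightarrow> l" using s(2) by (simp add: comp_def)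
    then show ?thesis
      by (intro tendsto_dist isCont_tendsto_compose[OF cont] tendsto_fst tendsto_snd)
  qed
  have "fst l = snd l"
  proof (rule separates_orbitsD[OF assms(3)])
    show "fst l \<in> Y" "snd l \<in> Y" using l by (auto simp: mem_Times_iff)
    fix k
    show "dist (iter_int f k (fst l)) (iter_int f k (snd l)) \<le> e"
    proof (rule LIMSEQ_le_const2[OF lim], intro exI allI impI)
      fix n assume "nat \<bar>k\<bar> \<le> n"
      then have "\<bar>k\<bar> \<le> int (s n)" using seq_suble[OF s(1), of n] by linarith
      then show "dist (iter_int f k (fst (q (s n)))) (iter_int f k (snd (q (s n)))) \<le> e" by (rule q(3))
    qed
  qed
  moreover have "r \<le> dist (iter_int f 0 (fst l)) (iter_int f 0 (snd l))"
    by (rule LIMSEQ_le_const[OF lim]) (use q(2) in \<open>auto intro: less_imp_le\<close>)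
  ultimately show False using assms(2) by simp
qed

section \<open>Itineraries\<close>

text \<open>
  An itinerary is a bi-infinite word; \<open>P\<close> will be the finite chain recurrent set. At a regular time the
  word sits on \<open>P\<close> and moves with \<open>f\<close>, so the next letter carries no information.
\<close>

definition irregular_times :: "'a set \<Rightarrow> (int \<Rightarrow> 'a) \<Rightarrow> int set" where
  "irregular_times P w = {i. \<not> (w i \<in> P \<and> w (i + 1) = f (w i))}"

text \<open>
  The times are kept next to the letters so that restricting a record to a time interval is an
  intersection of sets.
\<close>

definition itinerary_record :: "'a set \<Rightarrow> (int \<Rightarrow> 'a) \<Rightarrow> (int \<times> 'a \<times> 'a) set" where
  "itinerary_record P w = (\<lambda>i. (i, w i, w (i + 1))) ` irregular_times P w"

definition sparse_itineraries :: "'a set \<Rightarrow> 'a set \<Rightarrow> 'a set \<Rightarrow> nat \<Rightarrow> real \<Rightarrow> bool" where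
  "sparse_itineraries Y P K M \<rho> \<longleftrightarrow> finite K \<and>
     (\<forall>z\<in>Y. \<exists>w. (\<forall>i. w i \<in> K \<and> dist (iter_int f i z) (w i) \<le> \<rho>) \<and>
        finite (irregular_times P w) \<and> card (irregular_times P w) \<le> M)"

text \<open>
  The statement is an equivalence because the word has to be recovered in both time directions; the
  backward direction uses that \<open>f\<close> is injective.
\<close>

lemma record_determines_step:
  assumes "itinerary_record P w \<inter> {i} \<times> UNIV = itinerary_record P w' \<inter> {i} \<times> UNIV"
  shows "w i = w' i \<longleftrightarrow> w (i + 1) = w' (i + 1)"
proof (cases "i \<in> irregular_times P w \<or> i \<in> irregular_times P w'")
  case True
  then have "(i, w i, w (i + 1)) \<in> itinerary_record P w' \<or> (i, w' i, w' (i + 1)) \<in> itinerary_record P w"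
    using assms unfolding itinerary_record_def by blast
  then show ?thesis by (auto simp: itinerary_record_def)
next
  case False
  then show ?thesis by (simp add: irregular_times_def)
qed

lemma record_determines_forward:
  assumes "w 0 = w' 0" "itinerary_record P w \<inter> {0..<L} \<times> UNIV = itinerary_record P w' \<inter> {0..<L} \<times> UNIV"
    and "int n \<le> L"
  shows "w (int n) = w' (int n)"
  using assms(3)
proof (induction n)
  case 0
  then show ?case using assms(1) by simp
next
  case (Suc n)
  have "{int n} \<times> UNIV \<subseteq> {0..<L} \<times> UNIV" using Suc.prems by auto
  then have "itinerary_record P w \<inter> {int n} \<times> UNIV = itinerary_record P w' \<inter> {int n} \<times> UNIV"
    using assms(2) by blast
  then have "w (int n) = w' (int n) \<longleftrightarrow> w (int n + 1) = w' (int n + 1)"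
    by (rule record_determines_step)
  then show ?case using Suc by (simp add: add.commute)
qed

lemma record_determines:
  assumes "w 0 = w' 0" "itinerary_record P w = itinerary_record P w'"
  shows "w i = w' i"
proof (induction i rule: int_induct[where k = 0])
  case base
  then show ?case using assms(1) by simp
next
  case (step1 i)
  then show ?case using record_determines_step[of P w i w'] assms(2) by simp
next
  case (step2 i)
  then show ?case using record_determines_step[of P w "i - 1" w'] assms(2) by simp
qed

lemma record_subset:
  assumes "\<And>i. w i \<in> K"
  shows "itinerary_record P w \<subseteq> UNIV \<times> K \<times> K"
  using assms by (auto simp: itinerary_record_def)

text \<open>
  By expansivity the itinerary determines the point, and the letter at time \<open>0\<close> together with the finite
  record determines the itinerary.
\<close>

lemma countable_if_sparse_itineraries:
  assumes "sparse_itineraries Y P K M (e / 2)" "separates_orbits e Y"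
  shows "countable Y"
proof -
  obtain W where W: "\<And>z i. z \<in> Y \<Longrightarrow> W z i \<in> K"
    "\<And>z i. z \<in> Y \<Longrightarrow> dist (iter_int f i z) (W z i) \<le> e / 2"
    "\<And>z. z \<in> Y \<Longrightarrow> finite (irregular_times P (W z))"
    using assms(1) unfolding sparse_itineraries_def by metis
  define code where "code z = (W z 0, itinerary_record P (W z))" for z
  have K: "finite K" using assms(1) by (simp add: sparse_itineraries_def)
  have "code ` Y \<subseteq> K \<times> {T. finite T \<and> T \<subseteq> UNIV \<times> K \<times> K}"
    using W(1,3) record_subset[of "W _" K P] by (auto simp: code_def itinerary_record_def)
  moreover have "countable (K \<times> {T. finite T \<and> T \<subseteq> (UNIV :: int set) \<times> K \<times> K})"
    using K by (intro countable_SIGMA countable_Collect_finite_subset) (auto intro: countable_finite)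
  ultimately have "countable (code ` Y)" by (rule countable_subset)
  moreover have "inj_on code Y"
  proof (rule inj_onI)
    fix z z' assume z: "z \<in> Y" "z' \<in> Y" "code z = code z'"
    show "z = z'"
    proof (rule separates_orbitsD[OF assms(2) z(1,2)])
      fix i
      have "W z i = W z' i" using z(3) record_determines[of "W z" "W z'" P] by (simp add: code_def)
      then show "dist (iter_int f i z) (iter_int f i z') \<le> e"
        using W(2)[OF z(1), of i] W(2)[OF z(2), of i]
          dist_triangle2[of "iter_int f i z" "iter_int f i z'" "W z i"] by simp
    qed
  qed
  ultimately show ?thesis by (rule countable_image_inj_on)
qed

lemma card_small_subsets:
  assumes "finite A"
  shows "card {T. T \<subseteq> A \<and> card T \<le> M} \<le> (M + 1) * (card A + 1) ^ M"
proof -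
  have "{T. T \<subseteq> A \<and> card T \<le> M} = (\<Union>k\<in>{..M}. {T. T \<subseteq> A \<and> card T = k})" by auto
  then have "card {T. T \<subseteq> A \<and> card T \<le> M} \<le> (\<Sum>k\<in>{..M}. card {T. T \<subseteq> A \<and> card T = k})"
    by (simp add: card_UN_le)
  also have "\<dots> = (\<Sum>k\<in>{..M}. card A choose k)" by (simp add: n_subsets[OF assms])
  also have "\<dots> \<le> (\<Sum>k\<in>{..M}. (card A + 1) ^ M)"
  proof (rule sum_mono)
    fix k assume k: "k \<in> {..M}"
    have "card A choose k \<le> card A ^ k"
      by (cases "k \<le> card A") (auto simp: binomial_le_pow binomial_eq_0)
    also have "\<dots> \<le> (card A + 1) ^ k" by (rule power_mono) auto
    also have "\<dots> \<le> (card A + 1) ^ M" using k by (intro power_increasing) auto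
    finally show "card A choose k \<le> (card A + 1) ^ M" .
  qed
  finally show ?thesis by simp
qed

text \<open>
  A separated set at scale \<open>r\<close> is injected into the words of length \<open>L = n + 2 * N\<close> read off from time
  \<open>- N\<close> on, where \<open>N\<close> is the uniform expansivity time for \<open>r\<close>. Such a word is given by its first letter and
  a record of at most \<open>M\<close> entries, which leaves only polynomially many possibilities in \<open>n\<close>.
\<close>

lemma entropy_0_if_sparse_itineraries:
  assumes "sparse_itineraries Y P K M (e / 2)" "separates_orbits e Y" "closed Y" "f ` Y = Y"
  shows "topological_entropy Y f = 0"
  unfolding topological_entropy_eq_0_iff
proof (intro allI impI)
  fix r :: real assume r: "0 < r"
  obtain W where W: "\<And>z i. z \<in> Y \<Longrightarrow> W z i \<in> K"
    "\<And>z i. z \<in> Y \<Longrightarrow> dist (iter_int f i z) (W z i) \<le> e / 2"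
    "\<And>z. z \<in> Y \<Longrightarrow> finite (irregular_times P (W z))"
    "\<And>z. z \<in> Y \<Longrightarrow> card (irregular_times P (W z)) \<le> M"
    using assms(1) unfolding sparse_itineraries_def by metis
  have K: "finite K" using assms(1) by (simp add: sparse_itineraries_def)
  obtain N :: nat where N: "\<And>x y. x \<in> Y \<Longrightarrow> y \<in> Y \<Longrightarrow>
    (\<And>k. \<bar>k\<bar> \<le> int N \<Longrightarrow> dist (iter_int f k x) (iter_int f k y) \<le> e) \<Longrightarrow> dist x y \<le> r"
    using uniform_expansivity[OF assms(3) r assms(2)] by metis
  define B where "B = (1 + 2 * N) * (card K * card K) + 1"
  show "sep_growth Y f r = 0"
  proof (rule sep_growth_eq_0I[OF r, of Y "card K * ((M + 1) * B ^ M)" M])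
    fix n E assume n: "n \<ge> 1" and E: "finite E" "E \<subseteq> Y" "separated f n r E"
    define L where "L = int n + 2 * int N"
    define u where "u z = iter_int f (- int N) z" for z
    have u: "u z \<in> Y" if "z \<in> E" for z
      using iter_int_in_invariant[OF assms(4)] E(2) that by (auto simp: u_def)
    define code where "code z = (W (u z) 0, itinerary_record P (W (u z)) \<inter> {0..<L} \<times> UNIV)" for z
    define A where "A = {0..<L} \<times> K \<times> K"
    have finA: "finite A" using K by (simp add: A_def)
    have cardA: "card A = (n + 2 * N) * (card K * card K)"
      by (simp add: A_def L_def card_cartesian_product nat_add_distrib nat_mult_distrib)
    have "code ` E \<subseteq> K \<times> {T. T \<subseteq> A \<and> card T \<le> M}"
    proof
      fix q assume "q \<in> code ` E"
      then obtain z where z: "z \<in> E" "q = code z" by blast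
      let ?w = "W (u z)"
      have "itinerary_record P ?w \<inter> {0..<L} \<times> UNIV \<subseteq> A"
        using record_subset[of ?w K P] W(1)[OF u[OF z(1)]] unfolding A_def by blast
      moreover have "card (itinerary_record P ?w \<inter> {0..<L} \<times> UNIV) \<le> M"
      proof -
        have fin: "finite (itinerary_record P ?w)" using W(3)[OF u[OF z(1)]] by (simp add: itinerary_record_def)
        have "card (itinerary_record P ?w \<inter> {0..<L} \<times> UNIV) \<le> card (itinerary_record P ?w)"
          by (rule card_mono[OF fin]) blast
        also have "\<dots> \<le> card (irregular_times P ?w)"
          unfolding itinerary_record_def by (rule card_image_le) (rule W(3)[OF u[OF z(1)]])
        also have "\<dots> \<le> M" by (rule W(4)[OF u[OF z(1)]])
        finally show ?thesis .
      qed
      ultimately show "q \<in> K \<times> {T. T \<subseteq> A \<and> card T \<le> M}"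
        using W(1)[OF u[OF z(1)]] z(2) by (simp add: code_def)
    qed
    moreover have "finite {T. T \<subseteq> A \<and> card T \<le> M}"
      using finA by (rule rev_finite_subset[OF finite_Pow_iff[THEN iffD2]]) blast
    moreover have "inj_on code E"
    proof (rule inj_onI, rule ccontr)
      fix x y assume xy: "x \<in> E" "y \<in> E" "code x = code y" "x \<noteq> y"
      obtain j where j: "j < n" "dist ((f ^^ j) x) ((f ^^ j) y) > r"
        using E(3) xy by (auto simp: separated_iff[OF n])
      have "dist (iter_int f (int j) x) (iter_int f (int j) y) \<le> r"
      proof (rule N)
        show "iter_int f (int j) x \<in> Y" "iter_int f (int j) y \<in> Y"
          using iter_int_in_invariant[OF assms(4)] E(2) xy by auto
        fix k assume k: "\<bar>k\<bar> \<le> int N"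
        define t where "t = nat (k + int j + int N)"
        have t: "k + int j = int t + (- int N)" "int t \<le> L"
          using k j(1) by (auto simp: t_def L_def)
        have shift: "iter_int f k (iter_int f (int j) z) = iter_int f (int t) (u z)" for z
          unfolding u_def iter_int_add[symmetric] t(1) ..
        have "W (u x) (int t) = W (u y) (int t)"
          by (rule record_determines_forward[of _ _ P L]) (use xy(3) t(2) in \<open>auto simp: code_def\<close>)
        then show "dist (iter_int f k (iter_int f (int j) x)) (iter_int f k (iter_int f (int j) y)) \<le> e"
          using W(2)[OF u[OF xy(1)], of "int t"] W(2)[OF u[OF xy(2)], of "int t"]
            dist_triangle2[of "iter_int f (int t) (u x)" "iter_int f (int t) (u y)" "W (u x) (int t)"]
          by (simp add: shift)
      qed
      then show False using j(2) by (simp add: iter_int_of_nat)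
    qed
    ultimately have "card E \<le> card (K \<times> {T. T \<subseteq> A \<and> card T \<le> M})"
      using K by (intro card_inj_on_le) auto
    also have "\<dots> = card K * card {T. T \<subseteq> A \<and> card T \<le> M}" by (rule card_cartesian_product)
    also have "\<dots> \<le> card K * ((M + 1) * (card A + 1) ^ M)"
      by (rule mult_le_mono2[OF card_small_subsets[OF finA]])
    also have "\<dots> \<le> card K * ((M + 1) * (n * B) ^ M)"
    proof -
      have "n + 2 * N \<le> n * (1 + 2 * N)" using n by (simp add: algebra_simps)
      then have "card A \<le> n * (1 + 2 * N) * (card K * card K)" unfolding cardA by (rule mult_le_mono1)
      then have "card A + 1 \<le> n * B" using n by (simp add: B_def algebra_simps)
      then show ?thesis by (intro mult_le_mono2 power_mono) auto
    qed
    also have "\<dots> = card K * ((M + 1) * B ^ M) * n ^ M" by (simp add: power_mult_distrib algebra_simps)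
    finally show "card E \<le> card K * ((M + 1) * B ^ M) * n ^ M" .
  qed
qed

end

section \<open>Orbits near a set with finite chain recurrence\<close>

lemma finite_separation:
  assumes "finite (P :: 'a::metric_space set)"
  obtains \<sigma> where "0 < \<sigma>" "\<And>p q. p \<in> P \<Longrightarrow> q \<in> P \<Longrightarrow> dist p q < \<sigma> \<Longrightarrow> p = q"
proof -
  let ?D = "insert 1 ((\<lambda>(p, q). dist p q) ` {(p, q) \<in> P \<times> P. p \<noteq> q})"
  have fin: "finite ?D"
    using assms by (auto intro!: finite_imageI intro: finite_subset[of _ "P \<times> P"])
  show ?thesis
  proof (rule that[of "Min ?D"])
    show "0 < Min ?D" using fin by (subst Min_gr_iff) auto
    fix p q assume pq: "p \<in> P" "q \<in> P" "dist p q < Min ?D"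
    show "p = q"
    proof (rule ccontr)
      assume "p \<noteq> q"
      then have "Min ?D \<le> dist p q" using pq(1,2) fin by (intro Min_le) auto
      then show False using pq(3) by simp
    qed
  qed
qed

context compact_homeo
begin

text \<open>
  The points of \<open>\<Lambda>\<close> at distance \<open>\<ge> \<eta>\<close> from the chain recurrent set form a compact set. Each of them has a
  scale at which it lies on no loop, and that scale works in a neighbourhood.
\<close>

lemma no_loops_off_chain_recurrent_set:
  assumes "closed \<Lambda>" "0 < \<eta>"
  obtains \<delta> where "0 < \<delta>" "\<And>x. x \<in> \<Lambda> \<Longrightarrow>
    (\<And>p. p \<in> chain_recurrent_set \<Lambda> f \<Longrightarrow> \<eta> \<le> dist x p) \<Longrightarrow> \<not> (step_rel \<Lambda> f \<delta>)\<^sup>+\<^sup>+ x x"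
proof -
  let ?P = "chain_recurrent_set \<Lambda> f"
  define S where "S = {x \<in> \<Lambda>. \<forall>p\<in>?P. \<eta> \<le> dist x p}"
  have "S = \<Lambda> \<inter> (\<Inter>p\<in>?P. {x. \<eta> \<le> dist x p})" by (auto simp: S_def)
  moreover have "closed {x. \<eta> \<le> dist x p}" for p :: 'a
    by (intro closed_Collect_le continuous_intros)
  ultimately have "closed S" using assms(1) by auto
  have "\<exists>\<eta>>0. \<forall>y. dist y x \<le> \<eta> \<longrightarrow> \<not> (step_rel \<Lambda> f \<eta>)\<^sup>+\<^sup>+ y y" if "x \<in> S" for x
  proof -
    have x: "x \<in> \<Lambda>" "x \<notin> ?P" using that assms(2) by (auto simp: S_def)
    then obtain \<delta> where "\<delta> > 0" "\<not> (step_rel \<Lambda> f \<delta>)\<^sup>+\<^sup>+ x x"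
      by (auto simp: chain_recurrent_set_iff)
    then show ?thesis using loops_stable[OF x(1), of \<delta>] by metis
  qed
  then obtain d where d: "\<And>x. x \<in> S \<Longrightarrow> d x > 0"
    "\<And>x y. x \<in> S \<Longrightarrow> dist y x \<le> d x \<Longrightarrow> \<not> (step_rel \<Lambda> f (d x))\<^sup>+\<^sup>+ y y"
    by metis
  obtain C where C: "C \<subseteq> S" "finite C" "S \<subseteq> (\<Union>x\<in>C. ball x (d x))"
  proof (rule compactE_image[OF closed_imp_compact[OF \<open>closed S\<close>], of S "\<lambda>x. ball x (d x)"])
    show "S \<subseteq> (\<Union>x\<in>S. ball x (d x))" using d(1) by force
  qed auto
  let ?D = "insert 1 (d ` C)"
  have fin: "finite ?D" using C(2) by simp
  show ?thesis
  proof (rule that[of "Min ?D"])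
    show "0 < Min ?D" using fin C(1) d(1) by (subst Min_gr_iff) auto
    fix x assume "x \<in> \<Lambda>" "\<And>p. p \<in> ?P \<Longrightarrow> \<eta> \<le> dist x p"
    then have "x \<in> S" by (simp add: S_def)
    then obtain c where c: "c \<in> C" "x \<in> ball c (d c)" using C(3) by blast
    then have "\<not> (step_rel \<Lambda> f (d c))\<^sup>+\<^sup>+ x x" using d(2)[of c x] C(1) by (auto simp: dist_commute)
    moreover have "Min ?D \<le> d c" using fin c(1) by (intro Min_le) auto
    ultimately show "\<not> (step_rel \<Lambda> f (Min ?D))\<^sup>+\<^sup>+ x x" using tranclp_step_rel_mono by blast
  qed
qed

text \<open>
  Trace an orbit in the \<open>\<epsilon>\<close>-neighbourhood by points \<open>x i\<close> of \<open>\<Lambda>\<close>, which form a fine chain. If \<open>x i\<close> and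
  \<open>x j\<close> were close to each other and away from the chain recurrent set \<open>P\<close>, the chain between them would
  close up to a forbidden loop; so the size of a net bounds the set \<open>J\<close> of times spent away from \<open>P\<close>.
  At other times the letter is the nearby point of \<open>P\<close>; two consecutive such letters \<open>p\<close>, \<open>q\<close> satisfy
  \<open>q = f p\<close>, since \<open>f p\<close> and \<open>q\<close> are closer than the minimal distance \<open>\<sigma>\<close> within \<open>P\<close>. A time can only be
  irregular if it or its successor belongs to \<open>J\<close>, hence the factor \<open>2\<close>.
\<close>

lemma sparse_itineraries_near:
  assumes "closed \<Lambda>" "f ` \<Lambda> = \<Lambda>" "finite (chain_recurrent_set \<Lambda> f)" "0 < \<rho>"
  obtains \<epsilon> K M where "0 < \<epsilon>"
    "sparse_itineraries (invariant_part f (closed_nbhd \<epsilon> \<Lambda>)) (chain_recurrent_set \<Lambda> f) K M \<rho>"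
proof -
  define P where "P = chain_recurrent_set \<Lambda> f"
  have fP: "f p \<in> P" if "p \<in> P" for p
    using image_chain_recurrent_set[OF assms(2)] that by (auto simp: P_def)
  obtain \<sigma> where \<sigma>: "0 < \<sigma>" "\<And>p q. p \<in> P \<Longrightarrow> q \<in> P \<Longrightarrow> dist p q < \<sigma> \<Longrightarrow> p = q"
    using finite_separation[of P] assms(3) by (auto simp: P_def)
  obtain \<eta> where \<eta>: "0 < \<eta>" "\<eta> \<le> min (\<sigma> / 4) (\<rho> / 2)"
    "\<And>x y. dist x y \<le> \<eta> \<Longrightarrow> dist (f x) (f y) \<le> min (\<sigma> / 4) (\<rho> / 2)"
    using uniform_continuity[OF continuous_f, of "min (\<sigma> / 4) (\<rho> / 2)"] \<sigma>(1) assms(4) by auto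
  obtain \<delta>0 where \<delta>0: "0 < \<delta>0" "\<And>x. x \<in> \<Lambda> \<Longrightarrow>
    (\<And>p. p \<in> P \<Longrightarrow> \<eta> \<le> dist x p) \<Longrightarrow> \<not> (step_rel \<Lambda> f \<delta>0)\<^sup>+\<^sup>+ x x"
    using no_loops_off_chain_recurrent_set[OF assms(1) \<eta>(1)] unfolding P_def by metis
  define \<delta> where "\<delta> = min \<delta>0 (\<sigma> / 4)"
  have \<delta>: "0 < \<delta>" "\<delta> \<le> \<delta>0" "\<delta> \<le> \<sigma> / 4" using \<delta>0(1) \<sigma>(1) by (auto simp: \<delta>_def)
  obtain \<theta> where \<theta>: "0 < \<theta>" "\<theta> \<le> \<delta> / 4" "\<And>x y. dist x y \<le> \<theta> \<Longrightarrow> dist (f x) (f y) \<le> \<delta> / 4"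
    using uniform_continuity[OF continuous_f, of "\<delta> / 4"] \<delta>(1) by auto
  define \<epsilon> where "\<epsilon> = min \<theta> (\<rho> / 2) / 2"
  have \<epsilon>: "0 < \<epsilon>" "2 * \<epsilon> \<le> \<theta>" "2 * \<epsilon> \<le> \<rho> / 2" using \<theta>(1) assms(4) by (auto simp: \<epsilon>_def)
  obtain C :: "'a set" where C: "finite C" "\<And>x. \<exists>k\<in>C. dist x k \<le> \<delta> / 4"
    using finite_net[of "\<delta> / 4"] \<delta>(1) by (metis divide_pos_pos zero_less_numeral)
  obtain c where c: "\<And>x. c x \<in> C" "\<And>x. dist x (c x) \<le> \<delta> / 4" using C(2) by metis
  obtain K :: "'a set" where K: "finite K" "\<And>x. \<exists>k\<in>K. dist x k \<le> \<rho>"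
    using finite_net[OF assms(4)] by metis
  obtain \<kappa> where \<kappa>: "\<And>x. \<kappa> x \<in> K" "\<And>x. dist x (\<kappa> x) \<le> \<rho>" using K(2) by metis
  have "sparse_itineraries (invariant_part f (closed_nbhd \<epsilon> \<Lambda>)) P (P \<union> K) (2 * card C) \<rho>"
    unfolding sparse_itineraries_def
  proof (intro conjI ballI)
    show "finite (P \<union> K)" using assms(3) K(1) by (simp add: P_def)
    fix z assume z: "z \<in> invariant_part f (closed_nbhd \<epsilon> \<Lambda>)"
    have "\<exists>y\<in>\<Lambda>. dist (iter_int f i z) y < 2 * \<epsilon>" for i
      using closed_nbhdE[of "iter_int f i z" \<epsilon> \<Lambda> "2 * \<epsilon>"] z \<epsilon>(1) by (auto simp: invariant_part_iff)
    then obtain x where x: "\<And>i. x i \<in> \<Lambda>" "\<And>i. dist (iter_int f i z) (x i) < 2 * \<epsilon>" by metis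
    have step: "dist (f (x i)) (x (i + 1)) \<le> \<delta> / 2" for i
    proof -
      have "dist (f (iter_int f i z)) (f (x i)) \<le> \<delta> / 4"
        using x(2)[of i] \<epsilon>(2) by (intro \<theta>(3)) simp
      moreover have "dist (f (iter_int f i z)) (x (i + 1)) \<le> \<delta> / 4"
        using x(2)[of "i + 1"] \<epsilon>(2) \<theta>(2) by (simp add: iter_int_succ)
      ultimately show ?thesis
        using dist_triangle3[of "f (x i)" "x (i + 1)" "f (iter_int f i z)"] by linarith
    qed
    have chain: "(step_rel \<Lambda> f (\<delta> / 2))\<^sup>+\<^sup>+ (x i) (x (i + 1 + int n))" for i n
    proof (induction n)
      case 0
      show ?case using x(1) step by (auto simp: step_rel_def)
    next
      case (Suc n)
      have "step_rel \<Lambda> f (\<delta> / 2) (x (i + 1 + int n)) (x (i + 1 + int n + 1))"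
        using x(1) step[of "i + 1 + int n"] by (simp add: step_rel_def)
      moreover have "i + 1 + int n + 1 = i + 1 + int (Suc n)" by simp
      ultimately show ?case using Suc by (metis tranclp.trancl_into_trancl)
    qed
    define J where "J = {i. \<forall>p\<in>P. \<eta> \<le> dist (x i) p}"
    have cx: "c (x i) \<noteq> c (x j)" if "i \<in> J" "i < j" for i j
    proof
      assume eq: "c (x i) = c (x j)"
      have "dist (x j) (x i) \<le> \<delta> / 2"
        using c(2)[of "x i"] c(2)[of "x j"] dist_triangle2[of "x j" "x i" "c (x i)"] eq by simp
      moreover have "(step_rel \<Lambda> f (\<delta> / 2))\<^sup>+\<^sup>+ (x i) (x j)"
        using chain[of i "nat (j - i - 1)"] that(2) by simp
      ultimately have "(step_rel \<Lambda> f (\<delta> / 2 + \<delta> / 2))\<^sup>+\<^sup>+ (x i) (x i)"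
        using step_rel_change_end x(1) \<delta>(1) by (metis half_gt_zero less_imp_le)
      then have "(step_rel \<Lambda> f \<delta>0)\<^sup>+\<^sup>+ (x i) (x i)"
        by (rule tranclp_step_rel_mono[rotated]) (use \<delta>(2) in simp)
      then show False using \<delta>0(2)[of "x i"] x(1) that(1) by (auto simp: J_def)
    qed
    have inj: "inj_on (\<lambda>i. c (x i)) J"
    proof (rule inj_onI)
      fix i j assume "i \<in> J" "j \<in> J" "c (x i) = c (x j)"
      then show "i = j" using cx[of i j] cx[of j i] by (metis linorder_neqE)
    qed
    have J: "finite J" "card J \<le> card C"
      using inj_on_finite[OF inj _ C(1)] card_inj_on_le[OF inj _ C(1)] c(1) by auto
    have "\<exists>p\<in>P. dist (x i) p < \<eta>" if "i \<notin> J" for i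
      using that by (auto simp: J_def not_le)
    then obtain \<pi> where \<pi>: "\<And>i. i \<notin> J \<Longrightarrow> \<pi> i \<in> P" "\<And>i. i \<notin> J \<Longrightarrow> dist (x i) (\<pi> i) < \<eta>"
      by metis
    define w where "w i = (if i \<in> J then \<kappa> (iter_int f i z) else \<pi> i)" for i
    have w: "w i \<in> P \<union> K \<and> dist (iter_int f i z) (w i) \<le> \<rho>" for i
    proof (cases "i \<in> J")
      case True
      then show ?thesis using \<kappa> by (simp add: w_def)
    next
      case False
      have "dist (iter_int f i z) (\<pi> i) \<le> \<rho>"
        using x(2)[of i] \<pi>(2)[OF False] \<epsilon>(3) \<eta>(2)
          dist_triangle[of "iter_int f i z" "\<pi> i" "x i"] by simp
      then show ?thesis using \<pi>(1)[OF False] False by (simp add: w_def)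
    qed
    have sub: "irregular_times P w \<subseteq> J \<union> (\<lambda>i. i - 1) ` J"
    proof
      fix i assume i: "i \<in> irregular_times P w"
      show "i \<in> J \<union> (\<lambda>i. i - 1) ` J"
      proof (rule ccontr)
        assume "i \<notin> J \<union> (\<lambda>i. i - 1) ` J"
        then have iJ: "i \<notin> J" "i + 1 \<notin> J" by force+
        have "dist (f (\<pi> i)) (f (x i)) \<le> \<sigma> / 4"
          using \<eta>(3)[of "\<pi> i" "x i"] \<pi>(2)[OF iJ(1)] by (simp add: dist_commute)
        moreover have "dist (f (x i)) (x (i + 1)) \<le> \<sigma> / 4" using step[of i] \<delta> by linarith
        moreover have "dist (x (i + 1)) (\<pi> (i + 1)) \<le> \<sigma> / 4"
          using \<pi>(2)[OF iJ(2)] \<eta>(2) by simp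
        ultimately have "dist (f (\<pi> i)) (\<pi> (i + 1)) < \<sigma>"
          using dist_triangle[of "f (\<pi> i)" "\<pi> (i + 1)" "f (x i)"]
            dist_triangle[of "f (x i)" "\<pi> (i + 1)" "x (i + 1)"] \<sigma>(1) by linarith
        then have "f (\<pi> i) = \<pi> (i + 1)"
          using \<sigma>(2) fP \<pi>(1) iJ by blast
        then show False using i iJ \<pi>(1) by (simp add: irregular_times_def w_def)
      qed
    qed
    have fin: "finite (J \<union> (\<lambda>i. i - 1) ` J)" using J(1) by simp
    have "card (irregular_times P w) \<le> card (J \<union> (\<lambda>i. i - 1) ` J)"
      by (rule card_mono[OF fin sub])
    also have "\<dots> \<le> 2 * card C"
      using card_Un_le[of J "(\<lambda>i. i - 1) ` J"] card_image_le[OF J(1), of "\<lambda>i. i - 1"] J(2) by linarith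
    finally have card: "card (irregular_times P w) \<le> 2 * card C" .
    show "\<exists>w. (\<forall>i. w i \<in> P \<union> K \<and> dist (iter_int f i z) (w i) \<le> \<rho>) \<and>
        finite (irregular_times P w) \<and> card (irregular_times P w) \<le> 2 * card C"
      using w finite_subset[OF sub fin] card by (intro exI[of _ w]) simp
  qed
  then show ?thesis using that[OF \<epsilon>(1)] unfolding P_def by blast
qed

section \<open>Locally maximal neighbourhoods\<close>

text \<open>
  All points of an orbit in \<open>V \<epsilon>0\<close> lie in \<open>V \<epsilon>0\<close> themselves, so no such orbit has a point whose distance
  to \<open>\<Lambda>\<close> falls in a gap of the set \<open>D\<close> of distances. For \<open>\<epsilon>\<close> in a gap, \<open>V \<epsilon>\<close> equals \<open>V (\<epsilon> + s)\<close> for some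
  \<open>s > 0\<close>, and orbits close enough to \<open>V \<epsilon>\<close> belong to the latter.
\<close>

lemma locally_maximal_nbhd:
  assumes "0 < \<epsilon>0" "countable (invariant_part f (closed_nbhd \<epsilon>0 \<Lambda>))"
  obtains \<epsilon> where "0 < \<epsilon>" "\<epsilon> < \<epsilon>0" "locally_maximal f (invariant_part f (closed_nbhd \<epsilon> \<Lambda>))"
proof -
  let ?V = "\<lambda>\<epsilon>. invariant_part f (closed_nbhd \<epsilon> \<Lambda>)"
  define D where "D = (\<lambda>z. infdist z \<Lambda>) ` ?V \<epsilon>0"
  have "countable D" using assms(2) by (simp add: D_def)
  have "compact (?V \<epsilon>0)"
    by (intro closed_imp_compact closed_invariant_part closed_closed_nbhd)
  then have "compact D"
    unfolding D_def by (intro compact_continuous_image continuous_intros)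
  have "\<not> {0<..<\<epsilon>0} \<subseteq> D"
    using \<open>countable D\<close> uncountable_open_interval[of 0 \<epsilon>0] assms(1) countable_subset by blast
  then obtain \<epsilon> where \<epsilon>: "0 < \<epsilon>" "\<epsilon> < \<epsilon>0" "\<epsilon> \<notin> D"
    by (meson greaterThanLessThan_iff subsetI)
  have "open (- D)" using \<open>compact D\<close> by (simp add: compact_imp_closed open_Compl)
  then obtain r where r: "0 < r" "ball \<epsilon> r \<subseteq> - D"
    using \<epsilon>(3) by (meson ComplI open_contains_ball)
  define s where "s = min (r / 2) (\<epsilon>0 - \<epsilon>)"
  have s: "0 < s" "s < r" "\<epsilon> + s \<le> \<epsilon>0" using r(1) \<epsilon>(2) by (auto simp: s_def)
  have gap: "?V (\<epsilon> + s) \<subseteq> ?V \<epsilon>"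
  proof
    fix z assume z: "z \<in> ?V (\<epsilon> + s)"
    show "z \<in> ?V \<epsilon>"
      unfolding invariant_part_iff
    proof
      fix i
      let ?u = "iter_int f i z"
      have u: "?u \<in> ?V (\<epsilon> + s)" using z by (rule iter_int_in_invariant_part)
      then have uc: "?u \<in> closed_nbhd (\<epsilon> + s) \<Lambda>" using invariant_part_subset by blast
      have "?u \<in> ?V \<epsilon>0"
        using u invariant_part_mono[OF closed_nbhd_mono_radius[OF s(3)]] by blast
      then have "infdist ?u \<Lambda> \<notin> ball \<epsilon> r" using r(2) unfolding D_def by blast
      then have "infdist ?u \<Lambda> \<le> \<epsilon>"
        using uc s(2) by (auto simp: closed_nbhd_def dist_real_def)
      then show "?u \<in> closed_nbhd \<epsilon> \<Lambda>" using uc by (simp add: closed_nbhd_def)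
    qed
  qed
  have "closed_nbhd (s / 2) (?V \<epsilon>) \<subseteq> closed_nbhd (\<epsilon> + s) \<Lambda>"
  proof
    fix z assume "z \<in> closed_nbhd (s / 2) (?V \<epsilon>)"
    then obtain y where y: "y \<in> ?V \<epsilon>" "dist z y < s"
      using closed_nbhdE[of z "s / 2" _ s] s(1) by auto
    have "y \<in> closed_nbhd \<epsilon> \<Lambda>" using y(1) invariant_part_subset by blast
    then show "z \<in> closed_nbhd (\<epsilon> + s) \<Lambda>"
      using y(2) infdist_triangle[of z \<Lambda> y] by (auto simp: closed_nbhd_def)
  qed
  then have "invariant_part f (closed_nbhd (s / 2) (?V \<epsilon>)) \<subseteq> ?V \<epsilon>"
    using invariant_part_mono gap by blast
  moreover have "?V \<epsilon> \<subseteq> invariant_part f (closed_nbhd (s / 2) (?V \<epsilon>))"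
    using s(1) by (intro invariant_subset_invariant_part image_invariant_part subset_closed_nbhd) simp
  ultimately have "locally_maximal f (?V \<epsilon>)"
    unfolding locally_maximal_def
    using image_invariant_part closed_invariant_part[OF closed_closed_nbhd] s(1)
    by (metis half_gt_zero subset_antisym)
  then show ?thesis using that \<epsilon> by blast
qed

text \<open>
  Expansivity near \<open>\<Lambda>\<close> is used at the scale \<open>e\<close>, which is why the itineraries are taken with precision
  \<open>e / 2\<close>: two orbits with the same itinerary are then \<open>e\<close>-close at all times.
\<close>

lemma insensitive_imp_locally_maximal_entropy_0:
  assumes "closed \<Lambda>" "f ` \<Lambda> = \<Lambda>" "0 < b" "expansive_on f (closed_nbhd b \<Lambda>)"
    and "sensitive_points (chain_recurrent_set \<Lambda> f) f = {}" "0 < c"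
  shows "\<exists>\<Gamma>. closed \<Gamma> \<and> f ` \<Gamma> = \<Gamma> \<and> locally_maximal f \<Gamma> \<and>
     \<Lambda> \<subseteq> \<Gamma> \<and> \<Gamma> \<subseteq> closed_nbhd c \<Lambda> \<and> topological_entropy \<Gamma> f = 0"
proof -
  let ?V = "\<lambda>\<epsilon>. invariant_part f (closed_nbhd \<epsilon> \<Lambda>)"
  have V_mono: "?V \<epsilon> \<subseteq> ?V \<epsilon>'" if "\<epsilon> \<le> \<epsilon>'" for \<epsilon> \<epsilon>'
    by (intro invariant_part_mono closed_nbhd_mono_radius that)
  have sub: "\<Lambda> \<subseteq> ?V \<epsilon>" if "0 \<le> \<epsilon>" for \<epsilon>
    by (intro invariant_subset_invariant_part assms(2) subset_closed_nbhd that)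
  obtain e where e: "0 < e" "separates_orbits e (?V b)"
    using assms(4) unfolding expansive_on_iff_separates_orbits by blast
  have "finite (chain_recurrent_set \<Lambda> f)"
  proof (rule insensitive_expansive_finite)
    show "separates_orbits e (chain_recurrent_set \<Lambda> f)"
      using e(2) by (rule separates_orbits_subset)
        (use sub[of b] assms(3) in \<open>auto simp: chain_recurrent_set_def\<close>)
  qed (use assms e closed_chain_recurrent_set image_chain_recurrent_set in auto)
  then obtain \<epsilon>1 K M where \<epsilon>1: "0 < \<epsilon>1"
    "sparse_itineraries (?V \<epsilon>1) (chain_recurrent_set \<Lambda> f) K M (e / 2)"
    using sparse_itineraries_near[OF assms(1,2), of "e / 2"] e(1) by (metis half_gt_zero)
  define \<epsilon>0 where "\<epsilon>0 = min c (min b \<epsilon>1)"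
  have \<epsilon>0: "0 < \<epsilon>0" "\<epsilon>0 \<le> c" "\<epsilon>0 \<le> b" "\<epsilon>0 \<le> \<epsilon>1" using assms(3,6) \<epsilon>1(1) by (auto simp: \<epsilon>0_def)
  have sparse: "sparse_itineraries (?V \<epsilon>0) (chain_recurrent_set \<Lambda> f) K M (e / 2)"
    using \<epsilon>1(2) V_mono[OF \<epsilon>0(4)] unfolding sparse_itineraries_def by blast
  have sep: "separates_orbits e (?V \<epsilon>0)"
    using separates_orbits_subset[OF e(2) V_mono[OF \<epsilon>0(3)]] .
  have "countable (?V \<epsilon>0)" by (rule countable_if_sparse_itineraries[OF sparse sep])
  then obtain \<epsilon> where \<epsilon>: "0 < \<epsilon>" "\<epsilon> < \<epsilon>0" "locally_maximal f (?V \<epsilon>)"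
    using locally_maximal_nbhd[OF \<epsilon>0(1)] by metis
  have "topological_entropy (?V \<epsilon>0) f = 0"
    by (rule entropy_0_if_sparse_itineraries[OF sparse sep])
      (intro closed_invariant_part closed_closed_nbhd image_invariant_part)+
  then have "topological_entropy (?V \<epsilon>) f = 0"
    using topological_entropy_0_subset[OF V_mono] \<epsilon>(2) by (meson less_imp_le)
  moreover have "?V \<epsilon> \<subseteq> closed_nbhd c \<Lambda>"
    using invariant_part_subset closed_nbhd_mono_radius[of \<epsilon> c \<Lambda>] \<epsilon>(2) \<epsilon>0(2) by fastforce
  ultimately show ?thesis
    using \<epsilon>(1,3) sub[of \<epsilon>] image_invariant_part closed_invariant_part[OF closed_closed_nbhd]
    by (intro exI[of _ "?V \<epsilon>"]) auto
qed

lemma locally_maximal_imp_entropy_0_nbhd: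
  assumes "locally_maximal f \<Gamma>" "\<Lambda> \<subseteq> \<Gamma>" "topological_entropy \<Gamma> f = 0"
  shows "\<exists>\<epsilon>>0. topological_entropy (invariant_part f (closed_nbhd \<epsilon> \<Lambda>)) f = 0"
proof -
  obtain r where r: "r > 0" "\<Gamma> = invariant_part f (closed_nbhd r \<Gamma>)"
    using assms(1) unfolding locally_maximal_def by blast
  have "invariant_part f (closed_nbhd r \<Lambda>) \<subseteq> \<Gamma>"
    using invariant_part_mono[OF closed_nbhd_mono[OF assms(2), of r]] r(2) by simp
  then show ?thesis using topological_entropy_0_subset assms(3) r(1) by blast
qed

end

theorem theorem1p2:
  fixes f :: "'a::metric_space \<Rightarrow> 'a" and \<Lambda> :: "'a set"
  assumes "compact (UNIV :: 'a set)"
    and "homeomorphism UNIV UNIV f (inv f)"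
    and "closed \<Lambda>" and "f ` \<Lambda> = \<Lambda>"
    and "shadowing_on f \<Lambda>"
    and "\<exists>b>0. expansive_on f (closed_nbhd b \<Lambda>)"
  shows
    "(sensitive_points (chain_recurrent_set \<Lambda> f) f = {} \<longleftrightarrow>
        (\<exists>\<epsilon>>0. topological_entropy (invariant_part f (closed_nbhd \<epsilon> \<Lambda>)) f = 0)) \<and>
     ((\<exists>\<epsilon>>0. topological_entropy (invariant_part f (closed_nbhd \<epsilon> \<Lambda>)) f = 0) \<longleftrightarrow>
        (\<forall>c>0. \<exists>\<Gamma>. closed \<Gamma> \<and> f ` \<Gamma> = \<Gamma> \<and> locally_maximal f \<Gamma> \<and>
           \<Lambda> \<subseteq> \<Gamma> \<and> \<Gamma> \<subseteq> closed_nbhd c \<Lambda> \<and> topological_entropy \<Gamma> f = 0))"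
    (is "(?insensitive \<longleftrightarrow> ?nbhd) \<and> (?nbhd \<longleftrightarrow> ?maximal)")
proof -
  interpret compact_homeo f by unfold_locales (fact assms(1,2))+
  obtain b where b: "0 < b" "expansive_on f (closed_nbhd b \<Lambda>)" using assms(6) by blast
  have 1: ?maximal if ?insensitive
    using insensitive_imp_locally_maximal_entropy_0[OF assms(3,4) b that] by blast
  have 2: ?nbhd if ?maximal
    using locally_maximal_imp_entropy_0_nbhd that zero_less_one by meson
  have 3: ?insensitive if ?nbhd
    using sensitive_imp_entropy_nonzero[OF assms(4,5)] that by blast
  from 1 2 3 show ?thesis by blast
qed

end
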